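(* With the operators defined in the context, the operators $\mathcal{A}(\mathbb{k}_1),\dots,\mathcal{A}(\mathbb{k}_6)$ assigned to the simple closed curves $\mathbb{k}_1=\mathbb{x}_0$, $\mathbb{k}_2=\mathbb{y}_0$, $\mathbb{k}_3=\mathbb{y}$, $\mathbb{k}_4=\mathbb{y}_1$, $\mathbb{k}_5=\mathbb{x}_1$, $\mathbb{k}_6=\widetilde{\mathbb{y}}$ on the closed genus-two surface $\Sigma_{2,0}$ satisfy $$\mathcal{A}(\mathbb{k}_1)=\mathrm{ch}(\mathrm{i}\,\mathsf{T}_0)=\mathrm{ch}(\mathrm{i}\,\mathsf{T}_0^\vee),$$ $$\mathcal{A}(\mathbb{k}_2)=\mathrm{ch}(\mathrm{i}\,\mathsf{U}_0)=\mathrm{ch}(\mathrm{i}\,\mathsf{U}_0^\vee),$$ $$\mathcal{A}(\mathbb{k}_3)\,\mathsf{e}=\mathrm{ch}(\mathsf{T}_1\mathsf{T}_0)\,\mathsf{e}=\mathrm{ch}(\mathsf{T}_0\mathsf{T}_1)\,\mathsf{e},$$ $$\mathcal{A}(\mathbb{k}_4)\,\mathsf{e}=\mathrm{ch}(\mathrm{i}\,q^{-\frac12}\mathsf{U}_1)\,\mathsf{e}=\mathrm{ch}(\mathrm{i}\,\mathsf{U}_1^\vee)\,\mathsf{e},$$ $$\mathcal{A}(\mathbb{k}_5)\,\mathsf{e}=\mathrm{ch}(\mathrm{i}\,q^{-\frac12}\mathsf{T}_1)\,\mathsf{e}=\mathrm{ch}(\mathrm{i}\,\mathsf{T}_1^\vee)\,\mathsf{e},$$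 $$\mathcal{A}(\mathbb{k}_6)\,\mathsf{e}=\mathrm{ch}(\mathsf{U}_1\mathsf{U}_0)\,\mathsf{e}.$$
   Context: Let $q^{1/4},x_0,x_1,x$ be independent indeterminates, $F=\mathbb{C}(q^{1/4},x_0,x_1)$, and $\mathrm{i}=\sqrt{-1}$. For an invertible element (or operator) $z$ put $\mathrm{ch}(z)=z+z^{-1}$. All operators act on Laurent polynomials $f(x,x_0,x_1)\in F[x^{\pm1}]$ (expressions with denominators depending on $x$ are evaluated in $F(x)$). Products of operators are compositions, with the rightmost factor acting first, and functions of $x,x_0,x_1$ act by multiplication. The basic operators are $$(\mathsf{s}f)(x,x_0,x_1)=f(x^{-1},x_0,x_1),\qquad(\eth f)(x,x_0,x_1)=f(qx,x_0,x_1),$$ so that $(\mathsf{s}\,\eth f)(x)=f(qx^{-1})$, and $$(\eth_0f)(x,x_0,x_1)=f(x,q^{\frac12}x_0,x_1),\qquad(\eth_1f)(x,x_0,x_1)=f(x,x_0,q^{\frac12}x_1).$$ For $b=0,1$ define $$K_0(x_b,x)=\frac{-1}{1-x_b^2}\,\eth_b+\frac{(q^{\frac12}x+x_b^2)(q^{\frac32}x+x_b^2)}{q\,x\,(1-x_b^2)}\,\eth_b^{-1},$$ $$G_0(x_b,x)=\frac{-1}{1-x_b^2}\,\eth_b+\frac{(q^{\frac12}x+x_b^2)(q^{\frac12}+x\,x_b^2)}{q^{\frac12}\,x\,(1-x_b^2)}\,\eth_b^{-1}.$$ Here $K_0(x_b,x^{-1})$ means the same expression with $x$ replaced by $x^{-1}$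 in the coefficients. Also set $$\omega(x)=\frac{x(1+q^{\frac12}x)}{q^{\frac12}(1-x^2)(1-q^{\frac12}x)}.$$ Operators attached to curves. The map $\mathcal{A}$ is a map, constructed in earlier work, from the Kauffman bracket skein algebra $\mathrm{Sk}_{A=q^{-1/4}}(\Sigma_{2,0})$ to the operators on symmetric Laurent polynomials $F[x+x^{-1}]$. For the present statement only its values on six curves are needed. They are the following explicit operators (the first two are given by formulas that also act on all of $F[x^{\pm1}]$): $$\mathcal{A}(\mathbb{k}_1)=\mathcal{A}(\mathbb{x}_0)=\mathrm{ch}(x_0),\qquad\mathcal{A}(\mathbb{k}_2)=\mathcal{A}(\mathbb{y}_0)=\mathrm{i}\,q^{-\frac14}G_0(x_0,x),$$ $$\mathcal{A}(\mathbb{k}_5)=\mathcal{A}(\mathbb{x}_1)=\mathrm{ch}(x_1),\qquad\mathcal{A}(\mathbb{k}_4)=\mathcal{A}(\mathbb{y}_1)=\mathrm{i}\,q^{-\frac14}G_0(x_1,x),$$ $$\mathcal{A}(\mathbb{k}_3)=\mathcal{A}(\mathbb{y})=\sum_{\epsilon=\pm1}\omega(x^\epsilon)\left\{-x^{-\epsilon}\left(x_0+\frac{q^{\frac12}x^\epsilon}{x_0}\right)\left(x_1+\frac{q^{\frac12}x^\epsilon}{x_1}\right)\eth^\epsilon+q^{\frac12}\,\mathrm{ch}(x_0)\,\mathrm{ch}(x_1)\right\},$$ $$\mathcal{A}(\mathbb{k}_6)=\mathcal{A}(\widetilde{\mathbb{y}})=\sum_{\epsilon=\pm1}\omega(x^\epsilon)\left\{K_0(x_0,x^\epsilon)\,K_0(x_1,x^\epsilon)\,\eth^\epsilon-G_0(x_0,x)\,G_0(x_1,x)\right\}.$$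 Hecke operators (of the $C^\vee C_1$ double affine Hecke algebra at the special parameters $\mathbf{t}_\star=(\mathrm{i}x_0,\mathrm{i}q^{-1/2}x_1,\mathrm{i}x_0,\mathrm{i}x_1)$): $$\mathsf{T}_0=\mathrm{i}\,\frac{x}{q^{\frac12}-x}\left(-\frac{q^{\frac12}+x\,x_0^2}{x\,x_0}\,\mathsf{s}\,\eth+x_0+x_0^{-1}\right),$$ $$\mathsf{T}_1=\mathrm{i}\left(\frac{1+q^{\frac12}x}{q^{\frac12}(1-x^2)}\,\frac{q^{\frac12}x+x_1^2}{x_1}\,(\mathsf{s}-1)-q^{\frac12}x_1^{-1}\right),$$ $$\mathsf{T}_0^\vee=q^{-\frac12}\,\mathsf{T}_0^{-1}\,x,\qquad\mathsf{T}_1^\vee=x^{-1}\,\mathsf{T}_1^{-1}.$$ Heegaard dual operators: $$\mathsf{U}_0=\frac{q^{-\frac14}x}{q^{\frac12}-x}\,K_0(x_0,x^{-1})\,\mathsf{s}\,\eth-\frac{q^{-\frac14}x}{q^{\frac12}-x}\,G_0(x_0,x),$$ $$\mathsf{U}_1=-\frac{x(1+q^{\frac12}x)}{q^{\frac14}(1-x^2)}\,K_0(x_1,x)\,(\mathsf{s}-1)+\frac{q^{\frac14}}{1-q^{\frac12}x}\left(G_0(x_1,x)-q^{\frac12}x\,K_0(x_1,x)\right),$$ $$\mathsf{U}_0^\vee=q^{-\frac12}\,\mathsf{U}_0^{-1}\,x,\qquad\mathsf{U}_1^\vee=x^{-1}\,\mathsf{U}_1^{-1}.$$ The operators $\mathsf{T}_0,\mathsf{T}_1,\mathsf{U}_0,\mathsf{U}_1$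 are invertible. The idempotent $\mathsf{e}=\frac{1}{t_1+t_1^{-1}}(t_1+\mathsf{T}_1)$ with $t_1=\mathrm{i}q^{-1/2}x_1$ maps $F[x^{\pm1}]$ to $F[x+x^{-1}]$. Explicitly, $$\mathsf{e}=(1+\mathsf{s})\,\frac{(q^{\frac12}+x)(q^{\frac12}+x\,x_1^2)}{(1-x^2)(q-x_1^2)}.$$ *)

theory Defs
  imports "HOL-Computational_Algebra.Computational_Algebra"
begin

section \<open>Rational function fields and substitutions\<close>

type_synonym 'k ratfun = "'k poly fract"

definition rconst :: "'k::field \<Rightarrow> 'k ratfun" where
  "rconst c = to_fract [:c:]"

definition rvar :: "'k::field ratfun" where
  "rvar = to_fract [:0, 1:]"

text \<open>
  The extension of \<phi> : k \<rightarrow> m to k(t) \<rightarrow> m that sends t to y.  It is meaningful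
  only if \<phi> is a field homomorphism and y is transcendental over its image; then the value
  does not depend on how the argument is written as a fraction (see ratfun_eval_Fract).
\<close>

definition ratfun_eval :: "('k::field \<Rightarrow> 'm::field) \<Rightarrow> 'm \<Rightarrow> 'k ratfun \<Rightarrow> 'm" where
  "ratfun_eval \<phi> y f =
     (THE z. \<exists>a b. b \<noteq> 0 \<and> f = Fract a b \<and> z = poly (map_poly \<phi> a) y / poly (map_poly \<phi> b) y)"

lemma ratfun_eval_Fract:
  fixes \<phi> :: "'k::field \<Rightarrow> 'm::field"
  assumes hom: "\<phi> 1 = 1" "\<And>u v. \<phi> (u + v) = \<phi> u + \<phi> v" "\<And>u v. \<phi> (u * v) = \<phi> u * \<phi> v"
    and transc: "\<And>p. p \<noteq> 0 \<Longrightarrow> poly (map_poly \<phi> p) y \<noteq> 0"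
    and "b \<noteq> 0"
  shows "ratfun_eval \<phi> y (Fract a b) = poly (map_poly \<phi> a) y / poly (map_poly \<phi> b) y"
proof -
  have hom0: "\<phi> 0 = 0"
    using hom(2)[of 0 0] by (metis add.right_neutral add_left_cancel)
  have hom_sum: "\<phi> (sum g S) = (\<Sum>j\<in>S. \<phi> (g j))" if "finite S" for g :: "nat \<Rightarrow> 'k" and S
    using that by induction (auto simp: hom0 hom(2))
  have mult: "map_poly \<phi> (p * r) = map_poly \<phi> p * map_poly \<phi> r" for p r
    by (rule poly_eqI) (simp add: coeff_map_poly hom0 coeff_mult hom_sum hom(3))
  show ?thesis
    unfolding ratfun_eval_def
  proof (rule the_equality)
    show "\<exists>a' b'. b' \<noteq> 0 \<and> Fract a b = Fract a' b' \<and>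
        poly (map_poly \<phi> a) y / poly (map_poly \<phi> b) y =
        poly (map_poly \<phi> a') y / poly (map_poly \<phi> b') y"
      using \<open>b \<noteq> 0\<close> by blast
  next
    fix z
    assume "\<exists>a' b'. b' \<noteq> 0 \<and> Fract a b = Fract a' b' \<and>
        z = poly (map_poly \<phi> a') y / poly (map_poly \<phi> b') y"
    then obtain a' b' where *: "b' \<noteq> 0" "Fract a b = Fract a' b'"
        "z = poly (map_poly \<phi> a') y / poly (map_poly \<phi> b') y"
      by blast
    have "a * b' = a' * b"
      using * \<open>b \<noteq> 0\<close> by (simp add: eq_fract)
    then have "poly (map_poly \<phi> a) y * poly (map_poly \<phi> b') y =
        poly (map_poly \<phi> a') y * poly (map_poly \<phi> b) y"
      by (metis mult poly_mult)
    then show "z = poly (map_poly \<phi> a) y / poly (map_poly \<phi> b) y"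
      using *(1,3) \<open>b \<noteq> 0\<close> transc by (simp add: frac_eq_eq)
  qed
qed

text \<open>
  F is the rational function field in q^(1/4), x0, x1 over the complex numbers, built by adjoining
  the indeterminates in this order, and K = F(x).
\<close>

type_synonym F = "complex ratfun ratfun ratfun"
type_synonym K = "F ratfun"

definition cconst :: "complex \<Rightarrow> K" where
  "cconst c = rconst (rconst (rconst (rconst c)))"

definition im :: K where
  "im = cconst \<i>"

definition qroot :: K where
  "qroot = rconst (rconst (rconst rvar))"

definition xb :: "nat \<Rightarrow> K" where
  "xb b = (if b = 0 then rconst (rconst rvar) else rconst rvar)"

abbreviation x0 :: K where "x0 \<equiv> xb 0"
abbreviation x1 :: K where "x1 \<equiv> xb 1"

definition x :: K where
  "x = rvar"

text \<open>Exponents of q are counted in quarters: qpow n stands for q^(n/4).\<close>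

definition qpow :: "int \<Rightarrow> K" where
  "qpow n = qroot powi n"

text \<open>The substitution x0 := a0, x1 := a1, x := a, fixing complex numbers and q^(1/4).\<close>

definition subst_x :: "K \<Rightarrow> K \<Rightarrow> K \<Rightarrow> K \<Rightarrow> K" where
  "subst_x a0 a1 a =
     ratfun_eval (ratfun_eval (ratfun_eval (ratfun_eval cconst qroot) a0) a1) a"

definition laurent :: "K set" where
  "laurent = {f. \<exists>(p :: F poly) n. f = to_fract p / x ^ n}"


section \<open>Operators\<close>

text \<open>
  Operators are given by formulas on the whole of K, so that coefficients with denominators in x
  make sense; the operators proper are their restrictions to laurent.  In particular inverses
  are taken among the maps from laurent to itself; op_inv and ch_op are meaningful for operators
  that map laurent bijectively onto itself.
\<close>

type_synonym oper = "K \<Rightarrow> K"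

definition mult_op :: "K \<Rightarrow> oper" where
  "mult_op c = (\<lambda>f. c * f)"

definition op_inv :: "oper \<Rightarrow> oper" where
  "op_inv Z = inv_into laurent Z"

definition ch :: "K \<Rightarrow> K" where
  "ch z = z + inverse z"

definition ch_op :: "oper \<Rightarrow> oper" where
  "ch_op Z = (\<lambda>f. Z f + op_inv Z f)"

definition s :: oper where
  "s = subst_x x0 x1 (inverse x)"

text \<open>The powers eth^e and eth_b^e for an integer e.\<close>

definition eth :: "int \<Rightarrow> oper" where
  "eth e = subst_x x0 x1 (qpow (4 * e) * x)"

definition ethb :: "nat \<Rightarrow> int \<Rightarrow> oper" where
  "ethb b e = (if b = 0 then subst_x (qpow (2 * e) * x0) x1 x
               else subst_x x0 (qpow (2 * e) * x1) x)"

text \<open>The first argument b = 0, 1 selects x_b; the second replaces x in the coefficients.\<close>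

definition K0 :: "nat \<Rightarrow> K \<Rightarrow> oper" where
  "K0 b y = (\<lambda>f.
     - 1 / (1 - (xb b)\<^sup>2) * ethb b 1 f
     + (qpow 2 * y + (xb b)\<^sup>2) * (qpow 6 * y + (xb b)\<^sup>2) / (qpow 4 * y * (1 - (xb b)\<^sup>2))
       * ethb b (- 1) f)"

definition G0 :: "nat \<Rightarrow> K \<Rightarrow> oper" where
  "G0 b y = (\<lambda>f.
     - 1 / (1 - (xb b)\<^sup>2) * ethb b 1 f
     + (qpow 2 * y + (xb b)\<^sup>2) * (qpow 2 + y * (xb b)\<^sup>2) / (qpow 2 * y * (1 - (xb b)\<^sup>2))
       * ethb b (- 1) f)"

definition \<omega> :: "K \<Rightarrow> K" where
  "\<omega> y = y * (1 + qpow 2 * y) / (qpow 2 * (1 - y\<^sup>2) * (1 - qpow 2 * y))"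


subsection \<open>Operators attached to curves\<close>

text \<open>The simple closed curves x_0, y_0, y, y_1, x_1 and y-tilde on the closed surface of genus two, in
  this order.  Only the values on these curves of the representation of the skein algebra are
  used, so the map is given by its explicit values.\<close>

datatype curve = k1 | k2 | k3 | k4 | k5 | k6

primrec curve_op :: "curve \<Rightarrow> oper" (\<open>\<A>\<close>) where
  "\<A> k1 = mult_op (ch x0)"
| "\<A> k2 = mult_op (im * qpow (- 1)) \<circ> G0 0 x"
| "\<A> k3 = (\<lambda>f. \<Sum>e\<in>{1, - 1}.
     \<omega> (x powi e) *
       (- (x powi (- e)) * (x0 + qpow 2 * x powi e / x0) * (x1 + qpow 2 * x powi e / x1) * eth e f
        + qpow 2 * ch x0 * ch x1 * f))"
| "\<A> k4 = mult_op (im * qpow (- 1)) \<circ> G0 1 x"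
| "\<A> k5 = mult_op (ch x1)"
| "\<A> k6 = (\<lambda>f. \<Sum>e\<in>{1, - 1}.
     \<omega> (x powi e) * (K0 0 (x powi e) (K0 1 (x powi e) (eth e f)) - G0 0 x (G0 1 x f)))"


subsection \<open>Hecke operators and Heegaard dual operators\<close>

definition T0 :: oper where
  "T0 = (\<lambda>f. im * (x / (qpow 2 - x)) *
     (- ((qpow 2 + x * x0\<^sup>2) / (x * x0)) * s (eth 1 f) + (x0 + inverse x0) * f))"

definition T1 :: oper where
  "T1 = (\<lambda>f. im *
     ((1 + qpow 2 * x) / (qpow 2 * (1 - x\<^sup>2)) * ((qpow 2 * x + x1\<^sup>2) / x1) * (s f - f)
      - qpow 2 * inverse x1 * f))"

definition T0_dual :: oper where
  "T0_dual = mult_op (qpow (- 2)) \<circ> op_inv T0 \<circ> mult_op x"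

definition T1_dual :: oper where
  "T1_dual = mult_op (inverse x) \<circ> op_inv T1"

definition U0 :: oper where
  "U0 = (\<lambda>f. qpow (- 1) * x / (qpow 2 - x) * K0 0 (inverse x) (s (eth 1 f))
     - qpow (- 1) * x / (qpow 2 - x) * G0 0 x f)"

definition U1 :: oper where
  "U1 = (\<lambda>f. - (x * (1 + qpow 2 * x) / (qpow 1 * (1 - x\<^sup>2))) * K0 1 x (s f - f)
     + qpow 1 / (1 - qpow 2 * x) * (G0 1 x f - qpow 2 * x * K0 1 x f))"

definition U0_dual :: oper where
  "U0_dual = mult_op (qpow (- 2)) \<circ> op_inv U0 \<circ> mult_op x"

definition U1_dual :: oper where
  "U1_dual = mult_op (inverse x) \<circ> op_inv U1"

definition t1 :: K where
  "t1 = im * qpow (- 2) * x1"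

definition idem :: oper where
  "idem = (\<lambda>f. 1 / (t1 + inverse t1) * (t1 * f + T1 f))"

end

theory Submission
  imports Defs
begin

text \<open>
  Write p = q^(1/2), \<sigma> = s eth (so that (\<sigma> f)(x) = f(q/x)) and let "Laurent" mean Laurent polynomials in x.
  An operator Z that permutes the Laurent polynomials has a well-defined Z + Z^(-1), and everything
  rests on an explicit formula for Z^(-1).

  The operators s, eth and eth_b are field automorphisms of K = F(x), and an embedding of K is
  determined by its values on the generators.  This yields all commutation relations between them
  (\<open>K_embedding_ext\<close>).  Afterwards each claim becomes a comparison of coefficients in K.
  The operators have denominators such as p - x and 1 - x^2; they preserve Laurent polynomials
  because these denominators divide \<sigma> f - f and s f - f (\<open>laurent_divided_difference\<close>).

  The Hecke operators have the form A + B \<phi> with an involution \<phi> and satisfy a quadratic relation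
  Z^2 = 1 + \<tau> Z with a constant \<tau> as soon as A + \<phi>(A) = \<tau> and B \<phi>(B) - A \<phi>(A) = 1
  (\<open>reflection_operator_quadratic\<close>); thus Z^(-1) = Z - \<tau>.

  For U_0 the same computation works with operator coefficients.  Put L = K_0(x_0, 1/x) and
  G = G_0(x_0, x).  Then U_0 = u (L \<sigma> - G) for a function u with u + \<sigma>(u) = - q^(-1/4), and the relations
  L \<sigma> G = G L \<sigma> and (L \<sigma>)^2 = G^2 - (p - x)^2 / x say that U_0^(-1) = U_0 - q^(-1/4) G.

  For U_1 the argument is different.  It commutes with multiplication by symmetric Laurent
  polynomials with coefficients free of x_1, so it is studied on the decomposition f + x g of a Laurent
  polynomial with symmetric f and g.  In this form
  U_1 (f + x g) is a unit times h + \<mu> k, where h and k are symmetric, \<mu> is a fixed Laurent polynomial,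
  and (f, g) can be recovered from (h, k) (\<open>U1_symmetric_pair\<close>).  Since 1 and \<mu> also form
  a basis over the symmetric Laurent polynomials, U_1 is bijective.  On symmetric f, the only place where
  its inverse is needed, the solution is a single term: U_1^(-1) f = w eth_1^(-1) f (\<open>op_inv_U1\<close>).

  With these inverses the eleven identities are expanded on a Laurent polynomial f, which is symmetric
  where the idempotent has been applied first, and the coefficients are compared.
\<close>

section \<open>Field embeddings and rational functions\<close>

locale field_embedding =
  fixes \<phi> :: "'k::field \<Rightarrow> 'm::field"
  assumes one: "\<phi> 1 = 1"
    and add: "\<phi> (u + v) = \<phi> u + \<phi> v"
    and mult: "\<phi> (u * v) = \<phi> u * \<phi> v"
begin

lemma zero: "\<phi> 0 = 0"
  using add[of 0 0] by (metis add.right_neutral add_left_cancel)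

lemma uminus: "\<phi> (- u) = - \<phi> u"
  using add[of u "- u"] by (simp add: zero eq_neg_iff_add_eq_0 add.commute)

lemma diff: "\<phi> (u - v) = \<phi> u - \<phi> v"
  using add[of u "- v"] by (simp add: uminus)

lemma inverse: "\<phi> (inverse u) = inverse (\<phi> u)"
proof (cases "u = 0")
  case False
  then have "\<phi> u * \<phi> (inverse u) = 1"
    by (metis mult one right_inverse)
  then show ?thesis
    by (simp add: inverse_unique)
qed (simp add: zero)

lemma divide: "\<phi> (u / v) = \<phi> u / \<phi> v"
  by (simp add: divide_inverse mult inverse)

lemma power: "\<phi> (u ^ n) = \<phi> u ^ n"
  by (induction n) (simp_all add: one mult)

lemma power_int: "\<phi> (u powi n) = \<phi> u powi n"
  by (simp add: power_int_def power inverse)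

lemma eq_0_iff [simp]: "\<phi> u = 0 \<longleftrightarrow> u = 0"
  by (metis inverse mult one right_inverse zero mult_zero_left zero_neq_one)

lemma inj: "inj \<phi>"
  by (rule injI) (metis diff eq_0_iff right_minus_eq)

lemma numeral: "\<phi> (numeral k) = numeral k"
proof -
  have "\<phi> (of_nat n) = of_nat n" for n
    by (induction n) (simp_all add: zero one add)
  from this[of "Num.numeral k"] show ?thesis by simp
qed

lemma sum: "\<phi> (sum g A) = (\<Sum>a\<in>A. \<phi> (g a))"
  by (induction A rule: infinite_finite_induct) (simp_all add: zero add)

lemma poly: "\<phi> (poly p y) = poly (map_poly \<phi> p) (\<phi> y)"
  by (induction p) (simp_all add: zero add mult map_poly_pCons)

lemma map_poly_0_iff: "map_poly \<phi> p = 0 \<longleftrightarrow> p = 0"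
  by (simp add: poly_eq_iff coeff_map_poly zero)

lemma map_poly_add: "map_poly \<phi> (p + r) = map_poly \<phi> p + map_poly \<phi> r"
  by (rule poly_eqI) (simp add: coeff_map_poly zero add)

lemma map_poly_smult: "map_poly \<phi> (smult c p) = smult (\<phi> c) (map_poly \<phi> p)"
  by (rule poly_eqI) (simp add: coeff_map_poly zero mult)

lemma map_poly_mult: "map_poly \<phi> (p * r) = map_poly \<phi> p * map_poly \<phi> r"
  by (rule poly_eqI) (simp add: coeff_map_poly zero coeff_mult sum mult)

end

lemma field_embedding_comp:
  assumes "field_embedding \<phi>" "field_embedding \<psi>"
  shows "field_embedding (\<lambda>u. \<psi> (\<phi> u))"
  using assms by (simp add: field_embedding_def)

lemma to_fract_simps:
  "to_fract (p * r) = to_fract p * to_fract r" "to_fract (p + r) = to_fract p + to_fract r"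
  "to_fract 1 = 1" "to_fract 0 = 0"
  by (simp_all add: to_fract_def One_fract_def Zero_fract_def)

lemma field_embedding_rconst: "field_embedding (rconst :: 'k::field \<Rightarrow> 'k ratfun)"
proof
  show "rconst (1 :: 'k) = 1"
    by (simp add: rconst_def to_fract_simps flip: one_pCons)
  show "rconst (u + v) = rconst u + rconst v" for u v :: 'k
    by (simp add: rconst_def flip: to_fract_simps)
  show "rconst (u * v) = rconst u * rconst v" for u v :: 'k
    by (simp add: rconst_def flip: to_fract_simps)
qed

interpretation rconst: field_embedding "rconst :: 'k::field \<Rightarrow> 'k ratfun"
  by (rule field_embedding_rconst)

lemma to_fract_eq_poly: "to_fract p = poly (map_poly rconst p) rvar"
proof (induction p)
  case (pCons a p)
  have "pCons a p = [:a:] + [:0, 1:] * p" by simp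
  then have "to_fract (pCons a p) = rconst a + rvar * to_fract p"
    by (metis rconst_def rvar_def to_fract_simps(1,2))
  then show ?case using pCons by (simp add: map_poly_pCons rconst.zero)
qed (simp add: to_fract_simps)

lemma ratfun_cases:
  obtains a b where "b \<noteq> 0" "f = Fract a b" "f = to_fract a / to_fract b"
proof -
  obtain a b where "b \<noteq> 0" "f = Fract a b" by (cases f) auto
  moreover have "Fract a b = to_fract a / to_fract b"
    using \<open>b \<noteq> 0\<close> by (simp add: to_fract_def divide_fract)
  ultimately show ?thesis using that by blast
qed

text \<open>
  An embedding is determined on polynomials by the images of the constants and of the indeterminate, and
  every rational function is a quotient of polynomials.
\<close>

lemma ratfun_embedding_ext:
  assumes "field_embedding \<phi>" "field_embedding \<psi>"
    and "\<And>c. \<phi> (rconst c) = \<psi> (rconst c)" "\<phi> rvar = \<psi> rvar"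
  shows "\<phi> f = \<psi> f"
proof -
  interpret \<phi>: field_embedding \<phi> by fact
  interpret \<psi>: field_embedding \<psi> by fact
  have "\<phi> (to_fract p) = \<psi> (to_fract p)" for p
  proof -
    have "map_poly \<phi> (map_poly rconst p) = map_poly \<psi> (map_poly rconst p)"
      by (rule poly_eqI) (simp add: coeff_map_poly \<phi>.zero \<psi>.zero rconst.zero assms(3))
    then show ?thesis by (simp add: to_fract_eq_poly \<phi>.poly \<psi>.poly assms(4))
  qed
  then show ?thesis
    by (metis ratfun_cases \<phi>.divide \<psi>.divide)
qed

definition transcendental_over :: "('k::field \<Rightarrow> 'm::field) \<Rightarrow> 'm \<Rightarrow> bool" where
  "transcendental_over \<phi> y \<longleftrightarrow> (\<forall>p. p \<noteq> 0 \<longrightarrow> poly (map_poly \<phi> p) y \<noteq> 0)"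

context
  fixes \<phi> :: "'k::field \<Rightarrow> 'm::field" and y :: 'm
  assumes emb: "field_embedding \<phi>" and trans: "transcendental_over \<phi> y"
begin

interpretation field_embedding \<phi> by (rule emb)

lemma ratfun_eval_Fract':
  assumes "b \<noteq> 0"
  shows "ratfun_eval \<phi> y (Fract a b) = poly (map_poly \<phi> a) y / poly (map_poly \<phi> b) y"
  using ratfun_eval_Fract[OF one add mult _ assms] trans
  by (auto simp: transcendental_over_def)

lemma ratfun_eval_to_fract: "ratfun_eval \<phi> y (to_fract a) = poly (map_poly \<phi> a) y"
  by (simp add: to_fract_def ratfun_eval_Fract' map_poly_1 one)

lemma ratfun_eval_rconst: "ratfun_eval \<phi> y (rconst c) = \<phi> c"
  by (simp add: rconst_def ratfun_eval_to_fract map_poly_pCons zero)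

lemma ratfun_eval_rvar: "ratfun_eval \<phi> y rvar = y"
  by (simp add: rvar_def ratfun_eval_to_fract map_poly_pCons zero one)

lemma field_embedding_ratfun_eval: "field_embedding (ratfun_eval \<phi> y)"
proof
  have nz: "poly (map_poly \<phi> p) y \<noteq> 0" if "p \<noteq> 0" for p
    using trans that by (simp add: transcendental_over_def)
  show "ratfun_eval \<phi> y 1 = 1"
    using ratfun_eval_rconst[of 1] by (simp add: rconst.one one)
  fix f g :: "'k ratfun"
  obtain a b where f: "b \<noteq> 0" "f = Fract a b" by (cases f) auto
  obtain c d where g: "d \<noteq> 0" "g = Fract c d" by (cases g) auto
  show "ratfun_eval \<phi> y (f + g) = ratfun_eval \<phi> y f + ratfun_eval \<phi> y g"
    using f g nz by (simp add: ratfun_eval_Fract' map_poly_add map_poly_mult add_frac_eq mult.commute)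
  show "ratfun_eval \<phi> y (f * g) = ratfun_eval \<phi> y f * ratfun_eval \<phi> y g"
    using f g nz by (simp add: ratfun_eval_Fract' map_poly_mult)
qed

text \<open>
  A subfield that contains the images of the constants and the point of evaluation contains all values.
  This confines each stage of an iterated substitution to its own subfield of K.
\<close>

lemma ratfun_eval_range:
  assumes "field_embedding \<iota>" "range \<phi> \<subseteq> range \<iota>" "y \<in> range \<iota>"
  shows "range (ratfun_eval \<phi> y) \<subseteq> range \<iota>"
proof -
  interpret \<iota>: field_embedding \<iota> by fact
  have "poly (map_poly \<phi> a) y \<in> range \<iota>" for a
  proof (induction a)
    case 0 then show ?case using \<iota>.zero by (metis map_poly_0 poly_0 rangeI)
  next
    case (pCons c p)
    moreover obtain c' where "\<phi> c = \<iota> c'" using assms(2) by blast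
    ultimately show ?case using assms(3)
      by (auto simp: map_poly_pCons zero simp flip: \<iota>.add \<iota>.mult)
  qed
  then have "\<exists>u v. poly (map_poly \<phi> a) y = \<iota> u \<and> poly (map_poly \<phi> b) y = \<iota> v" for a b
    by blast
  then show ?thesis
  proof (intro subsetI, elim rangeE)
    fix z f
    assume z: "z = ratfun_eval \<phi> y f"
    obtain a b where f: "b \<noteq> 0" "f = Fract a b" by (cases f) auto
    from \<open>\<And>a b. \<exists>u v. poly (map_poly \<phi> a) y = \<iota> u \<and> poly (map_poly \<phi> b) y = \<iota> v\<close>[of a b]
    show "z \<in> range \<iota>" using z f by (auto simp: ratfun_eval_Fract' simp flip: \<iota>.divide)
  qed
qed

end

text \<open>
  Polynomials with coefficients in the image of \<phi> have coefficients in the image of \<iota>, because \<phi> factors through \<iota>.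
\<close>

lemma transcendental_over_range:
  assumes "field_embedding \<iota>" "transcendental_over \<iota> y" "field_embedding \<phi>"
    and "range \<phi> \<subseteq> range \<iota>"
  shows "transcendental_over \<phi> y"
  unfolding transcendental_over_def
proof (intro allI impI)
  interpret \<iota>: field_embedding \<iota> by fact
  interpret \<phi>: field_embedding \<phi> by fact
  fix p :: "'c poly"
  assume "p \<noteq> 0"
  define \<psi> where "\<psi> u = inv \<iota> (\<phi> u)" for u
  have \<psi>: "\<iota> (\<psi> u) = \<phi> u" for u
    using assms(4) unfolding \<psi>_def by (intro f_inv_into_f) blast
  have \<psi>0: "\<psi> 0 = 0" by (metis \<iota>.eq_0_iff \<phi>.zero \<psi>)
  have "map_poly \<iota> (map_poly \<psi> p) = map_poly \<phi> p"
    by (rule poly_eqI) (simp add: coeff_map_poly \<iota>.zero \<phi>.zero \<psi> \<psi>0)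
  moreover have "map_poly \<phi> p \<noteq> 0" using \<open>p \<noteq> 0\<close> by (simp add: \<phi>.map_poly_0_iff)
  ultimately show "poly (map_poly \<phi> p) y \<noteq> 0"
    using assms(2) by (metis map_poly_0 transcendental_over_def)
qed

lemma transcendental_over_comp:
  assumes "field_embedding \<iota>" "transcendental_over \<iota> y" "field_embedding \<psi>"
  shows "transcendental_over (\<lambda>u. \<psi> (\<iota> u)) (\<psi> y)"
  unfolding transcendental_over_def
proof (intro allI impI)
  interpret \<iota>: field_embedding \<iota> by fact
  interpret \<psi>: field_embedding \<psi> by fact
  fix p :: "'a poly"
  assume "p \<noteq> 0"
  then have "\<psi> (poly (map_poly \<iota> p) y) \<noteq> 0"
    using assms(2) by (simp add: transcendental_over_def)
  moreover have "map_poly \<psi> (map_poly \<iota> p) = map_poly (\<lambda>u. \<psi> (\<iota> u)) p"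
    by (rule poly_eqI) (simp add: coeff_map_poly \<iota>.zero \<psi>.zero)
  ultimately show "poly (map_poly (\<lambda>u. \<psi> (\<iota> u)) p) (\<psi> y) \<noteq> 0"
    by (simp add: \<psi>.poly)
qed

lemma transcendental_over_rvar: "transcendental_over rconst rvar"
  by (simp add: transcendental_over_def to_fract_def eq_fract Zero_fract_def flip: to_fract_eq_poly)

text \<open>
  A polynomial p vanishes at c t only if the polynomial p(c t) in t vanishes identically.
\<close>

lemma transcendental_over_scale:
  assumes "c \<noteq> 0"
  shows "transcendental_over rconst (rconst c * rvar)"
  unfolding transcendental_over_def
proof (intro allI impI)
  fix p :: "'a poly"
  assume "p \<noteq> 0"
  have "map_poly rconst (pcompose p [:0, c:]) = pcompose (map_poly rconst p) [:0, rconst c:]"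
    by (induction p)
      (simp_all add: pcompose_pCons rconst.map_poly_add rconst.map_poly_mult rconst.map_poly_smult map_poly_pCons rconst.zero)
  then have "poly (map_poly rconst p) (rconst c * rvar)
      = poly (map_poly rconst (pcompose p [:0, c:])) rvar"
    by (simp add: poly_pcompose mult.commute)
  moreover have "pcompose p [:0, c:] \<noteq> 0"
    using \<open>p \<noteq> 0\<close> \<open>c \<noteq> 0\<close> by (simp add: pcompose_eq_0_iff)
  ultimately show "poly (map_poly rconst p) (rconst c * rvar) \<noteq> 0"
    using transcendental_over_rvar unfolding transcendental_over_def by metis
qed

text \<open>
  The reflected polynomial takes the value y^n p(1/y) at y, so a relation for 1/y is one for y.
\<close>

lemma transcendental_over_inverse:
  assumes "transcendental_over \<phi> y" "field_embedding \<phi>"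
  shows "transcendental_over \<phi> (inverse y)"
  unfolding transcendental_over_def
proof (intro allI impI)
  interpret field_embedding \<phi> by fact
  fix p :: "'a poly"
  assume "p \<noteq> 0"
  have y: "y \<noteq> 0"
    using assms(1)[unfolded transcendental_over_def, rule_format, of "[:0, 1:]"]
    by (simp add: map_poly_pCons zero one)
  have "degree (map_poly \<phi> p) = degree p"
    by (rule degree_map_poly) simp
  then have "reflect_poly (map_poly \<phi> p) = map_poly \<phi> (reflect_poly p)"
    by (intro poly_eqI) (simp add: coeff_reflect_poly coeff_map_poly zero)
  moreover have "reflect_poly p \<noteq> 0" using \<open>p \<noteq> 0\<close> by simp
  ultimately have "poly (reflect_poly (map_poly \<phi> p)) y \<noteq> 0"
    using assms(1) by (simp add: transcendental_over_def)
  then show "poly (map_poly \<phi> p) (inverse y) \<noteq> 0"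
    using y by (simp add: poly_reflect_poly_nz)
qed

section \<open>Substitutions\<close>

lemma cconst_embedding: "field_embedding cconst"
  using field_embedding_comp[OF field_embedding_rconst field_embedding_comp[OF
        field_embedding_rconst field_embedding_comp[OF field_embedding_rconst field_embedding_rconst]]]
  by (simp add: cconst_def[abs_def])

text \<open>
  K is a tower of four simple transcendental extensions, and \<open>subst_x\<close> extends the identity of the complex
  numbers stage by stage.  The values at each stage lie in the corresponding subfield of K, over which the
  next argument is transcendental; this is what makes \<open>ratfun_eval\<close> an embedding at the next stage.
\<close>

context
  fixes b0 :: "complex ratfun ratfun" and b1 :: F and a :: K
  assumes b0: "transcendental_over rconst b0"
    and b1: "transcendental_over rconst b1"
    and a: "transcendental_over rconst a"
begin

lemma
  shows subst_x_embedding: "field_embedding (subst_x (rconst (rconst b0)) (rconst b1) a)"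
    and subst_x_cconst: "subst_x (rconst (rconst b0)) (rconst b1) a (cconst c) = cconst c"
    and subst_x_qroot: "subst_x (rconst (rconst b0)) (rconst b1) a qroot = qroot"
    and subst_x_x0: "subst_x (rconst (rconst b0)) (rconst b1) a x0 = rconst (rconst b0)"
    and subst_x_x1: "subst_x (rconst (rconst b0)) (rconst b1) a x1 = rconst b1"
    and subst_x_x: "subst_x (rconst (rconst b0)) (rconst b1) a x = a"
    and subst_x_rconst: "subst_x (rconst (rconst b0)) (rconst b1) a (rconst d) \<in> range rconst"
proof -
  note rc = field_embedding_rconst
  note rc2 = field_embedding_comp[OF rc rc]
  note rc3 = field_embedding_comp[OF rc2 rc]
  have t1: "transcendental_over cconst qroot"
    using transcendental_over_comp[OF rc transcendental_over_rvar rc3]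
    by (simp add: cconst_def[abs_def] qroot_def)
  define \<phi>1 where "\<phi>1 = ratfun_eval cconst qroot"
  have f1: "field_embedding \<phi>1"
    unfolding \<phi>1_def by (rule field_embedding_ratfun_eval[OF cconst_embedding t1])
  have r1: "range \<phi>1 \<subseteq> range (\<lambda>u. rconst (rconst (rconst u)))"
    unfolding \<phi>1_def by (rule ratfun_eval_range[OF cconst_embedding t1 rc3])
      (auto simp: cconst_def qroot_def)
  have t2: "transcendental_over \<phi>1 (rconst (rconst b0))"
    by (rule transcendental_over_range[OF rc3 transcendental_over_comp[OF rc b0 rc2] f1 r1])
  define \<phi>2 where "\<phi>2 = ratfun_eval \<phi>1 (rconst (rconst b0))"
  have f2: "field_embedding \<phi>2"
    unfolding \<phi>2_def by (rule field_embedding_ratfun_eval[OF f1 t2])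
  have r2: "range \<phi>2 \<subseteq> range (\<lambda>u. rconst (rconst u))"
    unfolding \<phi>2_def by (rule ratfun_eval_range[OF f1 t2 rc2]) (use r1 in auto)
  have t3: "transcendental_over \<phi>2 (rconst b1)"
    by (rule transcendental_over_range[OF rc2 transcendental_over_comp[OF rc b1 rc] f2 r2])
  define \<phi>3 where "\<phi>3 = ratfun_eval \<phi>2 (rconst b1)"
  have f3: "field_embedding \<phi>3"
    unfolding \<phi>3_def by (rule field_embedding_ratfun_eval[OF f2 t3])
  have r3: "range \<phi>3 \<subseteq> range rconst"
    unfolding \<phi>3_def by (rule ratfun_eval_range[OF f2 t3 rc]) (use r2 in auto)
  have t4: "transcendental_over \<phi>3 a"
    by (rule transcendental_over_range[OF rc a f3 r3])
  have S: "subst_x (rconst (rconst b0)) (rconst b1) a = ratfun_eval \<phi>3 a"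
    by (simp add: subst_x_def \<phi>3_def \<phi>2_def \<phi>1_def)
  note E = ratfun_eval_rconst[OF f3 t4] ratfun_eval_rconst[OF f2 t3, folded \<phi>3_def]
    ratfun_eval_rconst[OF f1 t2, folded \<phi>2_def] ratfun_eval_rconst[OF cconst_embedding t1, folded \<phi>1_def]
    ratfun_eval_rvar[OF f3 t4] ratfun_eval_rvar[OF f2 t3, folded \<phi>3_def]
    ratfun_eval_rvar[OF f1 t2, folded \<phi>2_def] ratfun_eval_rvar[OF cconst_embedding t1, folded \<phi>1_def]
  show "field_embedding (subst_x (rconst (rconst b0)) (rconst b1) a)"
    unfolding S by (rule field_embedding_ratfun_eval[OF f3 t4])
  show "subst_x (rconst (rconst b0)) (rconst b1) a (cconst c) = cconst c"
    "subst_x (rconst (rconst b0)) (rconst b1) a qroot = qroot"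
    "subst_x (rconst (rconst b0)) (rconst b1) a x0 = rconst (rconst b0)"
    "subst_x (rconst (rconst b0)) (rconst b1) a x1 = rconst b1"
    "subst_x (rconst (rconst b0)) (rconst b1) a x = a"
    unfolding S by (simp_all add: cconst_def E, simp_all add: qroot_def xb_def x_def E flip: cconst_def)
  show "subst_x (rconst (rconst b0)) (rconst b1) a (rconst d) \<in> range rconst"
    unfolding S using r3 by (auto simp: E)
qed

end

text \<open>
  Applying \<open>ratfun_embedding_ext\<close> once for each stage of the tower reduces equality of embeddings to the generators.
\<close>

lemma F_embedding_ext:
  assumes "field_embedding (\<phi> :: F \<Rightarrow> 'm::field)" "field_embedding \<psi>"
    and "\<And>c. \<phi> (rconst (rconst (rconst c))) = \<psi> (rconst (rconst (rconst c)))"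
    and "\<phi> (rconst (rconst rvar)) = \<psi> (rconst (rconst rvar))"
    and "\<phi> (rconst rvar) = \<psi> (rconst rvar)" "\<phi> rvar = \<psi> rvar"
  shows "\<phi> u = \<psi> u"
proof -
  note c = field_embedding_comp[OF field_embedding_rconst]
  have c1: "field_embedding (\<lambda>u. \<phi> (rconst u))" "field_embedding (\<lambda>u. \<psi> (rconst u))"
    by (rule c, fact)+
  have c2: "field_embedding (\<lambda>u. \<phi> (rconst (rconst u)))" "field_embedding (\<lambda>u. \<psi> (rconst (rconst u)))"
    by (rule c, fact c1)+
  have "\<phi> (rconst (rconst u)) = \<psi> (rconst (rconst u))" for u
    by (rule ratfun_embedding_ext[OF c2]) (use assms(3,4) in auto)
  then have "\<phi> (rconst u) = \<psi> (rconst u)" for u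
    by (rule ratfun_embedding_ext[OF c1]) (use assms(5) in auto)
  then show ?thesis
    by (rule ratfun_embedding_ext[OF assms(1,2)]) (use assms(6) in auto)
qed

lemma K_embedding_ext:
  assumes "field_embedding (\<phi> :: K \<Rightarrow> 'm::field)" "field_embedding \<psi>"
    and "\<And>c. \<phi> (cconst c) = \<psi> (cconst c)" "\<phi> qroot = \<psi> qroot"
    and "\<phi> x0 = \<psi> x0" "\<phi> x1 = \<psi> x1" "\<phi> x = \<psi> x"
  shows "\<phi> f = \<psi> f"
proof -
  note c = field_embedding_comp[OF field_embedding_rconst]
  have "\<phi> (rconst u) = \<psi> (rconst u)" for u
    by (rule F_embedding_ext[OF c[OF assms(1)] c[OF assms(2)]])
      (use assms(3-6) in \<open>auto simp: cconst_def qroot_def xb_def\<close>)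
  then show ?thesis
    by (rule ratfun_embedding_ext[OF assms(1,2)]) (use assms(7) in \<open>auto simp: x_def\<close>)
qed

lemma rvar_nz: "rvar \<noteq> (0 :: 'k::field ratfun)"
  by (simp add: rvar_def to_fract_def eq_fract Zero_fract_def)

lemma qroot_nz [simp]: "qroot \<noteq> 0"
  and x_nz [simp]: "x \<noteq> 0" and xb_nz [simp]: "xb b \<noteq> 0"
  by (auto simp: qroot_def x_def xb_def rvar_nz split: if_splits)

lemma qpow_nz [simp]: "qpow n \<noteq> 0"
  by (simp add: qpow_def)

lemma qpow_add: "qpow (m + n) = qpow m * qpow n"
  by (simp add: qpow_def power_int_add)

lemma qpow_0 [simp]: "qpow 0 = 1" by (simp add: qpow_def)

text \<open>
  The common shape of s, eth and eth_b: x_0 and x_1 are multiplied by powers of q, and x is inverted or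
  multiplied by a power of q.
\<close>

definition shift_subst :: "int \<Rightarrow> int \<Rightarrow> K \<Rightarrow> K \<Rightarrow> K" where
  "shift_subst m n = subst_x (qpow m * x0) (qpow n * x1)"

lemma shift_subst:
  assumes "a = inverse x \<or> a = qpow k * x"
  shows "field_embedding (shift_subst m n a)" "shift_subst m n a (cconst c) = cconst c"
    "shift_subst m n a qroot = qroot" "shift_subst m n a x0 = qpow m * x0"
    "shift_subst m n a x1 = qpow n * x1" "shift_subst m n a x = a"
    "shift_subst m n a (rconst d) \<in> range rconst"
proof -
  define b0 :: "complex ratfun ratfun" where "b0 = rconst (rvar powi m) * rvar"
  define b1 :: F where "b1 = rconst (rconst (rvar powi n)) * rvar"
  have 0: "qpow m * x0 = rconst (rconst b0)" and 1: "qpow n * x1 = rconst b1"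
    and k: "qpow k = rconst (rconst (rconst (rvar powi k)))"
    by (simp_all add: qpow_def qroot_def xb_def b0_def b1_def rconst.mult rconst.power_int)
  have "transcendental_over rconst b0" "transcendental_over rconst b1"
    unfolding b0_def b1_def by (intro transcendental_over_scale; simp add: rvar_nz)+
  moreover have "transcendental_over rconst a"
    using assms unfolding k x_def
    by (auto intro!: transcendental_over_scale transcendental_over_inverse transcendental_over_rvar
        field_embedding_rconst simp: rvar_nz)
  ultimately show "field_embedding (shift_subst m n a)" "shift_subst m n a (cconst c) = cconst c"
    "shift_subst m n a qroot = qroot" "shift_subst m n a x0 = qpow m * x0"
    "shift_subst m n a x1 = qpow n * x1" "shift_subst m n a x = a"
    "shift_subst m n a (rconst d) \<in> range rconst"
    unfolding shift_subst_def 0 1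
    by (fact subst_x_embedding subst_x_cconst subst_x_qroot subst_x_x0 subst_x_x1 subst_x_x subst_x_rconst)+
qed

section \<open>The elementary operators as field automorphisms\<close>

text \<open>
  All three families are instances of one substitution, so they inherit
  the homomorphism laws from \<open>shift_subst\<close>.
\<close>

lemma elementary_ops_shift_subst:
  "s = shift_subst 0 0 (inverse x)"
  "eth e = shift_subst 0 0 (qpow (4 * e) * x)"
  "ethb b e = (if b = 0 then shift_subst (2 * e) 0 (qpow 0 * x) else shift_subst 0 (2 * e) (qpow 0 * x))"
  by (simp_all add: s_def eth_def ethb_def shift_subst_def fun_eq_iff)

text \<open>
  The right-hand side is again an instance of the left-hand side, so this is a rewrite rule only for a fixed index b.
\<close>

lemma xb_1: "b \<noteq> 0 \<Longrightarrow> xb b = x1"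
  by (simp add: xb_def)

interpretation s: field_embedding s
  unfolding elementary_ops_shift_subst by (rule shift_subst, blast)

interpretation eth: field_embedding "eth e" for e
  unfolding elementary_ops_shift_subst by (rule shift_subst, blast)

interpretation ethb: field_embedding "ethb b e" for b e
  unfolding elementary_ops_shift_subst by (simp del: qpow_0, blast intro: shift_subst(1))

lemmas hom_simps =
  s.zero s.one s.numeral s.add s.uminus s.diff s.mult s.inverse s.divide s.power s.power_int
  eth.zero eth.one eth.numeral eth.add eth.uminus eth.diff eth.mult eth.inverse eth.divide eth.power eth.power_int
  ethb.zero ethb.one ethb.numeral ethb.add ethb.uminus ethb.diff ethb.mult ethb.inverse ethb.divide ethb.power ethb.power_int

lemma s_generators [simp]:
  "s (cconst c) = cconst c" "s qroot = qroot" "s (xb b) = xb b" "s x = inverse x"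
  using shift_subst(2)[of "inverse x" 0 0 0 c] shift_subst(3-6)[of "inverse x" 0 0 0]
  by (cases "b = 0"; simp add: elementary_ops_shift_subst xb_1[of b])+

lemma eth_generators [simp]:
  "eth e (cconst c) = cconst c" "eth e qroot = qroot" "eth e (xb b) = xb b"
  "eth e x = qpow (4 * e) * x"
  using shift_subst(2)[of "qpow (4 * e) * x" "4 * e" 0 0 c] shift_subst(3-6)[of "qpow (4 * e) * x" "4 * e" 0 0]
  by (cases "b = 0"; simp add: elementary_ops_shift_subst xb_1[of b])+

lemma ethb_generators [simp]:
  "ethb b e (cconst c) = cconst c" "ethb b e qroot = qroot" "ethb b e x = x"
  "ethb b e (xb b) = qpow (2 * e) * xb b"
  "(b = 0) \<noteq> (b' = 0) \<Longrightarrow> ethb b e (xb b') = xb b'"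
  using shift_subst(2)[of "qpow 0 * x" 0 "2 * e" 0 c] shift_subst(3-6)[of "qpow 0 * x" 0 "2 * e" 0]
    shift_subst(2)[of "qpow 0 * x" 0 0 "2 * e" c]
    shift_subst(3-6)[of "qpow 0 * x" 0 0 "2 * e"]
  by (cases "b = 0"; cases "b' = 0"; simp add: elementary_ops_shift_subst xb_1[of b] xb_1[of b'])+

text \<open>
  The case x_1 of the rule for x_b, in the form in which rewriting leaves the index 1.
\<close>

lemma ethb_x1 [simp]: "b \<noteq> 0 \<Longrightarrow> ethb b e (xb (Suc 0)) = qpow (2 * e) * xb (Suc 0)"
  using ethb_generators(4)[of b e] by (simp add: xb_1[of b])

lemma qpow_fixed [simp]: "s (qpow n) = qpow n" "eth e (qpow n) = qpow n" "ethb b e (qpow n) = qpow n"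
  by (simp_all add: qpow_def hom_simps)

lemma im_fixed [simp]: "s im = im" "eth e im = im" "ethb b e im = im"
  by (simp_all add: im_def)

text \<open>
  The commutation relations hold because both sides are embeddings with the same values on the generators.
\<close>

lemma s_s [simp]: "s (s f) = f"
  by (rule K_embedding_ext[of "\<lambda>f. s (s f)" "\<lambda>f. f"])
    (simp_all add: field_embedding_def hom_simps)

lemma eth_eth: "eth d (eth e f) = eth (d + e) f"
  by (rule K_embedding_ext[of "\<lambda>f. eth d (eth e f)"])
    (simp_all add: field_embedding_def hom_simps distrib_left qpow_add ac_simps)

lemma eth_0 [simp]: "eth 0 f = f"
  by (rule K_embedding_ext[of "eth 0" "\<lambda>f. f"]) (simp_all add: field_embedding_def hom_simps)

lemma qpow_uminus: "qpow (- n) = inverse (qpow n)"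
  by (simp add: qpow_def power_int_minus)

lemma s_eth: "s (eth e f) = eth (- e) (s f)"
  by (rule K_embedding_ext[of "\<lambda>f. s (eth e f)" "\<lambda>f. eth (- e) (s f)"])
    (simp_all add: field_embedding_def hom_simps qpow_uminus)

lemma ethb_s: "ethb b e (s f) = s (ethb b e f)"
  by (rule K_embedding_ext[of "\<lambda>f. ethb b e (s f)" "\<lambda>f. s (ethb b e f)"]; cases "b = 0")
    (simp_all add: field_embedding_def hom_simps xb_1[of b])

lemma ethb_eth: "ethb b e (eth d f) = eth d (ethb b e f)"
  by (rule K_embedding_ext[of "\<lambda>f. ethb b e (eth d f)" "\<lambda>f. eth d (ethb b e f)"]; cases "b = 0")
    (simp_all add: field_embedding_def hom_simps xb_1[of b])

lemma ethb_ethb: "ethb b d (ethb b e f) = ethb b (d + e) f"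
  by (rule K_embedding_ext[of "\<lambda>f. ethb b d (ethb b e f)"]; cases "b = 0")
    (simp_all add: field_embedding_def hom_simps xb_1[of b] distrib_left qpow_add ac_simps)

lemma ethb_0 [simp]: "ethb b 0 f = f"
  by (rule K_embedding_ext[of "ethb b 0" "\<lambda>f. f"]; cases "b = 0")
    (simp_all add: field_embedding_def hom_simps xb_1[of b])

lemma ethb_inverse: "ethb b 1 (ethb b (- 1) f) = f" "ethb b (- 1) (ethb b 1 f) = f"
  by (simp_all add: ethb_ethb)

lemma ethb_1_ethb_0: "ethb 1 d (ethb 0 e f) = ethb 0 e (ethb 1 d f)"
  by (rule K_embedding_ext[of "\<lambda>f. ethb 1 d (ethb 0 e f)" "\<lambda>f. ethb 0 e (ethb 1 d f)"])
    (simp_all add: field_embedding_def hom_simps del: One_nat_def)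

section \<open>Scalars\<close>

text \<open>The elements of F, that is, \<open>range rconst\<close>, are the coefficients of Laurent polynomials.\<close>

lemma const_closed:
  "c \<in> range rconst \<Longrightarrow> d \<in> range rconst \<Longrightarrow> c + d \<in> range rconst"
  "c \<in> range rconst \<Longrightarrow> d \<in> range rconst \<Longrightarrow> c - d \<in> range rconst"
  "c \<in> range rconst \<Longrightarrow> d \<in> range rconst \<Longrightarrow> c * d \<in> range rconst"
  "c \<in> range rconst \<Longrightarrow> d \<in> range rconst \<Longrightarrow> c / d \<in> range rconst"
  "c \<in> range rconst \<Longrightarrow> - c \<in> range rconst"
  "c \<in> range rconst \<Longrightarrow> inverse c \<in> range rconst"
  "c \<in> range rconst \<Longrightarrow> c ^ n \<in> range rconst"
  by (auto simp flip: rconst.add rconst.diff rconst.mult rconst.divide rconst.uminus rconst.inverse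
      rconst.power)

lemma const_0_1: "0 \<in> range rconst" "1 \<in> range rconst"
  by (metis rangeI rconst.zero) (metis rangeI rconst.one)

lemma const_generators: "qpow n \<in> range rconst" "im \<in> range rconst" "xb b \<in> range rconst"
  "qroot \<in> range rconst"
  by (auto simp: qpow_def qroot_def im_def cconst_def xb_def simp flip: rconst.power_int)

lemmas const_intros = const_closed const_0_1 const_generators

lemma const_ch_t1: "c \<in> range rconst \<Longrightarrow> ch c \<in> range rconst" "t1 \<in> range rconst"
  by (simp_all add: ch_def t1_def const_intros)

lemma s_const: "c \<in> range rconst \<Longrightarrow> s c = c"
  and eth_const: "c \<in> range rconst \<Longrightarrow> eth e c = c"
proof -
  note fe = field_embedding_comp[OF rconst.field_embedding_axioms]
  have "s (rconst d) = rconst d" for d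
    by (rule F_embedding_ext[OF fe[OF s.field_embedding_axioms] rconst.field_embedding_axioms])
      (use s_generators(1,2) s_generators(3)[of 0] s_generators(3)[of 1] in \<open>auto simp: cconst_def qroot_def xb_def split: if_splits\<close>)
  then show "c \<in> range rconst \<Longrightarrow> s c = c" by auto
  have "eth e (rconst d) = rconst d" for d
    by (rule F_embedding_ext[OF fe[OF eth.field_embedding_axioms] rconst.field_embedding_axioms])
      (use eth_generators(1,2) eth_generators(3)[of _ 0] eth_generators(3)[of _ 1] in \<open>auto simp: cconst_def qroot_def xb_def split: if_splits\<close>)
  then show "c \<in> range rconst \<Longrightarrow> eth e c = c" by auto
qed

lemma ethb_const: "c \<in> range rconst \<Longrightarrow> ethb b e c \<in> range rconst"
  unfolding elementary_ops_shift_subst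
  by (auto simp del: qpow_0 intro: shift_subst(7)[of _ 0])

lemma im_im: "im * im = - 1"
  by (simp add: im_def cconst_def flip: rconst.mult) (simp add: rconst.uminus rconst.one)

lemma inverse_im: "inverse im = - im"
  by (rule inverse_unique) (simp add: im_im)

lemma im_nz [simp]: "im \<noteq> 0"
  using im_im by force

lemma im_left: "im * (im * z) = - z"
  by (simp add: im_im flip: mult.assoc)

lemmas im_simps = im_im im_left

lemma t1_nz: "t1 \<noteq> 0" by (simp add: t1_def)

text \<open>
  The two abbreviations reduce every occurring power of q to the square root p of q and the fourth
  root r, which is related to p only through its square.
\<close>

abbreviation p :: K where "p \<equiv> qpow 2"

abbreviation r :: K where "r \<equiv> qroot"

lemma qpow_numerals:
  "qpow 1 = r" "qpow 4 = p\<^sup>2" "qpow 6 = p ^ 3"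
  "qpow (- 1) = inverse r" "qpow (- 2) = inverse p" "qpow (- 4) = inverse p ^ 2"
  by (simp_all add: qpow_def power_int_def flip: power_mult power_inverse)

lemma r_r: "r * r = p"
  by (simp add: qpow_def power_int_def power2_eq_square)

lemma p_r: "p = r\<^sup>2"
  by (simp add: r_r power2_eq_square)

text \<open>
  The denominators that occur below are nonzero because an indeterminate and its square
  do not lie in the field over which it is adjoined.
\<close>

lemma quadratic_irrational:
  assumes "c \<in> range rconst" shows "rvar\<^sup>2 \<noteq> c" "rvar \<noteq> c"
proof -
  obtain d where d: "c = rconst d" using assms by blast
  have "poly (map_poly rconst [:- d, 0, 1:]) rvar \<noteq> 0" "poly (map_poly rconst [:- d, 1:]) rvar \<noteq> 0"
    using transcendental_over_rvar unfolding transcendental_over_def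
    by (meson one_neq_zero pCons_eq_0_iff)+
  then show "rvar\<^sup>2 \<noteq> c" "rvar \<noteq> c"
    by (auto simp: d map_poly_pCons rconst.zero rconst.one rconst.uminus power2_eq_square)
qed

lemma x_not_const: "c \<in> range rconst \<Longrightarrow> x\<^sup>2 \<noteq> c" "c \<in> range rconst \<Longrightarrow> x \<noteq> c"
  by (simp_all add: x_def quadratic_irrational)

lemma xb_sq_neq_qpow: "(xb b)\<^sup>2 \<noteq> qpow n"
proof -
  have "qpow n = rconst (rconst (rconst (rvar powi n)))"
    by (simp add: qpow_def qroot_def rconst.power_int)
  moreover have "rvar\<^sup>2 \<noteq> rconst (rvar powi n)" "rvar\<^sup>2 \<noteq> rconst (rconst (rvar powi n))"
    by (simp_all add: quadratic_irrational)
  ultimately show ?thesis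
    by (auto simp: xb_def simp flip: rconst.power dest!: injD[OF rconst.inj])
qed

lemma x_neq:
  "p \<noteq> x" "x \<noteq> p" "x\<^sup>2 \<noteq> 1" "1 \<noteq> x\<^sup>2" "p * x \<noteq> 1" "1 \<noteq> p * x"
proof -
  show "p \<noteq> x" "x \<noteq> p" "x\<^sup>2 \<noteq> 1" "1 \<noteq> x\<^sup>2"
    using x_not_const by (metis const_intros)+
  have "x \<noteq> inverse p" by (intro x_not_const const_intros)
  then show "p * x \<noteq> 1" "1 \<noteq> p * x"
    by (metis inverse_unique)+
qed

lemma xb_sq_neq:
  "(xb b)\<^sup>2 \<noteq> 1" "1 \<noteq> (xb b)\<^sup>2" "(xb b)\<^sup>2 \<noteq> p\<^sup>2" "p\<^sup>2 \<noteq> (xb b)\<^sup>2"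
  "p\<^sup>2 * (xb b)\<^sup>2 \<noteq> 1" "1 \<noteq> p\<^sup>2 * (xb b)\<^sup>2"
proof -
  show "(xb b)\<^sup>2 \<noteq> 1" "1 \<noteq> (xb b)\<^sup>2" "(xb b)\<^sup>2 \<noteq> p\<^sup>2" "p\<^sup>2 \<noteq> (xb b)\<^sup>2"
    using xb_sq_neq_qpow[of b 0] xb_sq_neq_qpow[of b 4] by (auto simp: qpow_numerals)
  have "(xb b)\<^sup>2 \<noteq> inverse (p\<^sup>2)"
    using xb_sq_neq_qpow[of b "- 4"] by (simp add: qpow_numerals power_inverse)
  then show "p\<^sup>2 * (xb b)\<^sup>2 \<noteq> 1" "1 \<noteq> p\<^sup>2 * (xb b)\<^sup>2"
    by (metis inverse_unique)+
qed

section \<open>Laurent polynomials\<close>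

lemma laurent_const: "c \<in> range rconst \<Longrightarrow> c \<in> laurent"
  by (force simp: laurent_def rconst_def intro: exI[of _ 0])

lemma laurent_x: "x \<in> laurent" "inverse x \<in> laurent"
proof -
  have "x = to_fract [:0, 1:] / x ^ 0" "inverse x = to_fract 1 / x ^ 1"
    by (simp_all add: x_def rvar_def to_fract_simps inverse_eq_divide)
  then show "x \<in> laurent" "inverse x \<in> laurent"
    unfolding laurent_def by blast+
qed

lemma laurent_mult: "f \<in> laurent \<Longrightarrow> g \<in> laurent \<Longrightarrow> f * g \<in> laurent"
proof -
  assume "f \<in> laurent" "g \<in> laurent"
  then obtain p m r n where "f = to_fract p / x ^ m" "g = to_fract r / x ^ n"
    by (auto simp: laurent_def)
  then have "f * g = to_fract (p * r) / x ^ (m + n)"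
    by (simp add: to_fract_simps power_add)
  then show ?thesis unfolding laurent_def by blast
qed

lemma laurent_add: "f \<in> laurent \<Longrightarrow> g \<in> laurent \<Longrightarrow> f + g \<in> laurent"
proof -
  assume "f \<in> laurent" "g \<in> laurent"
  then obtain p m r n where fg: "f = to_fract p / x ^ m" "g = to_fract r / x ^ n"
    by (auto simp: laurent_def)
  have xn: "x ^ n = to_fract ([:0, 1:] ^ n)" for n
    by (induction n) (simp_all add: to_fract_simps(1,3) x_def rvar_def del: mult_pCons_left flip: one_pCons)
  have "f + g = (to_fract p * x ^ n + to_fract r * x ^ m) / x ^ (m + n)"
    by (simp add: fg power_add add_frac_eq)
  also have "\<dots> = to_fract (p * [:0, 1:] ^ n + r * [:0, 1:] ^ m) / x ^ (m + n)"
    by (simp only: to_fract_simps xn)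
  finally have "f + g = to_fract (p * [:0, 1:] ^ n + r * [:0, 1:] ^ m) / x ^ (m + n)" .
  then show ?thesis unfolding laurent_def by blast
qed

lemma laurent_uminus: "f \<in> laurent \<Longrightarrow> - f \<in> laurent"
  using laurent_mult[of "- 1" f] laurent_const[OF const_closed(5)[OF const_0_1(2)]] by simp

lemma laurent_diff: "f \<in> laurent \<Longrightarrow> g \<in> laurent \<Longrightarrow> f - g \<in> laurent"
  using laurent_add[of f "- g"] laurent_uminus[of g] by simp

lemma laurent_const_mult: "c \<in> range rconst \<Longrightarrow> f \<in> laurent \<Longrightarrow> c * f \<in> laurent"
  using laurent_mult[OF laurent_const] by blast

lemmas laurent_intros = laurent_x laurent_mult laurent_add laurent_uminus laurent_diff

lemma laurent_divide_const: "f \<in> laurent \<Longrightarrow> c \<in> range rconst \<Longrightarrow> f / c \<in> laurent"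
  by (simp add: divide_inverse laurent_mult laurent_const const_intros)

lemmas laurent_simps = laurent_intros laurent_divide_const laurent_const const_intros const_ch_t1

text \<open>Laurent polynomials are the ring generated by F, x and 1/x.\<close>

lemma laurent_induct [consumes 1, case_names const x inverse_x add mult]:
  assumes "f \<in> laurent"
    and "\<And>c. c \<in> range rconst \<Longrightarrow> P c" "P x" "P (inverse x)"
    and "\<And>f g. f \<in> laurent \<Longrightarrow> g \<in> laurent \<Longrightarrow> P f \<Longrightarrow> P g \<Longrightarrow> P (f + g)"
    and "\<And>f g. f \<in> laurent \<Longrightarrow> g \<in> laurent \<Longrightarrow> P f \<Longrightarrow> P g \<Longrightarrow> P (f * g)"
  shows "P f"
proof -
  obtain p n where f: "f = to_fract p * inverse x ^ n"
    using assms(1) by (auto simp: laurent_def divide_inverse power_inverse)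
  have "inverse x ^ n \<in> laurent \<and> P (inverse x ^ n)" for n
    by (induction n) (use assms(2)[OF const_0_1(2)] assms(4,6) in
        \<open>auto intro: laurent_intros laurent_const const_intros\<close>)
  moreover have "to_fract p \<in> laurent \<and> P (to_fract p)"
  proof (induction p)
    case 0 then show ?case using assms(2)[OF const_0_1(1)]
      by (auto intro: laurent_const const_intros simp: to_fract_simps)
  next
    case (pCons c p)
    have "to_fract (pCons c p) = rconst c + x * to_fract p"
      by (simp add: to_fract_eq_poly map_poly_pCons rconst.zero x_def)
    then show ?case using pCons assms(2)[of "rconst c"]
      by (simp add: assms laurent_intros laurent_const)
  qed
  ultimately show ?thesis
    unfolding f by (intro assms(6)) auto
qed

lemma laurent_s: "f \<in> laurent \<Longrightarrow> s f \<in> laurent"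
  by (induction rule: laurent_induct)
    (auto simp: hom_simps s_const intro: laurent_intros laurent_const)

lemma laurent_eth: "f \<in> laurent \<Longrightarrow> eth e f \<in> laurent"
  by (induction rule: laurent_induct)
    (auto simp: hom_simps eth_const qpow_nz intro: laurent_intros laurent_const_mult laurent_const const_intros)

lemma laurent_ethb: "f \<in> laurent \<Longrightarrow> ethb b e f \<in> laurent"
  by (induction rule: laurent_induct)
    (auto simp: hom_simps intro: laurent_intros laurent_const ethb_const)

text \<open>
  The map that sends f to (\<phi> f - f) / d is a twisted derivation: its value on f g is \<phi>(f) times its value on g
  plus g times its value on f.  Hence divisibility has to be checked for the generators x and 1/x only.
\<close>

lemma laurent_divided_difference:
  assumes "field_embedding \<phi>" "\<And>f. f \<in> laurent \<Longrightarrow> \<phi> f \<in> laurent" "\<And>c. c \<in> range rconst \<Longrightarrow> \<phi> c = c"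
    and "(\<phi> x - x) / d \<in> laurent" "(\<phi> (inverse x) - inverse x) / d \<in> laurent"
    and "f \<in> laurent"
  shows "(\<phi> f - f) / d \<in> laurent"
proof -
  interpret emb: field_embedding \<phi> by fact
  show ?thesis
    using assms(6)
  proof (induction rule: laurent_induct)
    case (const c)
    then show ?case by (simp add: assms(3) laurent_const const_intros)
  next
    case (add f g)
    have "(\<phi> (f + g) - (f + g)) / d = (\<phi> f - f) / d + (\<phi> g - g) / d"
      by (simp add: emb.add diff_divide_distrib add_divide_distrib)
    then show ?case by (simp only:) (intro laurent_add add.IH)
  next
    case (mult f g)
    have "(\<phi> (f * g) - f * g) / d = \<phi> f * ((\<phi> g - g) / d) + g * ((\<phi> f - f) / d)"
      by (simp add: emb.mult diff_divide_distrib algebra_simps)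
    then show ?case by (simp only:) (intro laurent_add laurent_mult assms(2) mult.IH mult.hyps)
  qed (use assms(4,5) in auto)
qed

lemma laurent_divided_difference_s:
  assumes "f \<in> laurent" shows "(s f - f) / (1 - x\<^sup>2) \<in> laurent"
proof (rule laurent_divided_difference[OF s.field_embedding_axioms laurent_s s_const _ _ assms])
  have "(s x - x) / (1 - x\<^sup>2) = inverse x" "(s (inverse x) - inverse x) / (1 - x\<^sup>2) = - inverse x"
    using x_neq by (simp_all add: hom_simps divide_simps) (simp_all add: power2_eq_square)
  then show "(s x - x) / (1 - x\<^sup>2) \<in> laurent" "(s (inverse x) - inverse x) / (1 - x\<^sup>2) \<in> laurent"
    by (simp_all add: laurent_intros)
qed

abbreviation sigma :: oper (\<open>\<sigma>\<close>) where "\<sigma> f \<equiv> s (eth 1 f)"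

interpretation sigma: field_embedding "\<lambda>f. \<sigma> f"
  by (rule field_embedding_comp[OF eth.field_embedding_axioms s.field_embedding_axioms])

lemma sigma_sigma: "\<sigma> (\<sigma> f) = f"
  by (simp add: s_eth eth_eth)

lemma sigma_x: "\<sigma> x = p\<^sup>2 / x"
  by (simp add: hom_simps qpow_numerals divide_inverse)

lemma sigma_const: "c \<in> range rconst \<Longrightarrow> \<sigma> c = c"
  by (simp add: eth_const s_const)

lemma sigma_ops: "\<sigma> (f - g) = \<sigma> f - \<sigma> g" "\<sigma> (f + g) = \<sigma> f + \<sigma> g" "\<sigma> (f * g) = \<sigma> f * \<sigma> g"
  by (rule sigma.diff sigma.add sigma.mult)+

lemma laurent_sigma: "f \<in> laurent \<Longrightarrow> \<sigma> f \<in> laurent"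
  by (intro laurent_s laurent_eth)

lemma laurent_divided_difference_sigma:
  assumes "f \<in> laurent" shows "(\<sigma> f - f) / (p - x) \<in> laurent"
proof (rule laurent_divided_difference[OF sigma.field_embedding_axioms laurent_sigma sigma_const _ _ assms])
  have "(\<sigma> x - x) / (p - x) = p * inverse x + 1"
    "(\<sigma> (inverse x) - inverse x) / (p - x) = - (inverse p + inverse (p\<^sup>2) * x) * inverse x"
    using x_neq by (simp_all add: hom_simps qpow_numerals divide_simps)
      (simp_all add: algebra_simps power2_eq_square)
  then show "(\<sigma> x - x) / (p - x) \<in> laurent" "(\<sigma> (inverse x) - inverse x) / (p - x) \<in> laurent"
    by (simp_all only:) (simp_all add: laurent_simps)
qed

text \<open>
  A Laurent polynomial is uniquely f = g + x h with symmetric g and h, where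
  s f - f = (1/x - x) h determines h.
\<close>

lemma symmetric_pair:
  assumes "f \<in> laurent"
  obtains g h where "f = g + x * h" "s g = g" "s h = h" "g \<in> laurent" "h \<in> laurent"
proof -
  define h where "h = x * ((s f - f) / (1 - x\<^sup>2))"
  have h: "h \<in> laurent"
    unfolding h_def by (intro laurent_intros laurent_divided_difference_s assms)
  have sh: "s h = h"
    using x_neq by (simp add: h_def hom_simps divide_simps) (simp add: algebra_simps power2_eq_square)
  have "s f - f = (inverse x - x) * h"
    using x_neq by (simp add: h_def divide_simps) (simp add: algebra_simps power2_eq_square)
  then have "s (f - x * h) = f - x * h"
    by (simp add: hom_simps sh algebra_simps)
  then show thesis
    by (intro that[of "f - x * h" h] sh h laurent_intros assms) simp_all
qed

lemma symmetric_ops: "s f = f \<Longrightarrow> s (ethb b e f) = ethb b e f"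
  by (simp flip: ethb_s)

section \<open>Inverses of operators on Laurent polynomials\<close>

lemma op_inv_eqI:
  assumes "bij_betw Z laurent laurent" "g \<in> laurent" "Z g = f"
  shows "op_inv Z f = g"
  using assms by (auto simp: op_inv_def bij_betw_def)

lemma bij_laurentI:
  assumes "\<And>f. f \<in> laurent \<Longrightarrow> Z f \<in> laurent" "\<And>f. f \<in> laurent \<Longrightarrow> W f \<in> laurent"
    and "\<And>f. f \<in> laurent \<Longrightarrow> W (Z f) = f" "\<And>f. f \<in> laurent \<Longrightarrow> Z (W f) = f"
  shows "bij_betw Z laurent laurent"
  by (rule bij_betw_byWitness[of _ W]) (use assms in auto)

lemma bij_mult_op:
  assumes "c \<in> laurent" "inverse c \<in> laurent" "c \<noteq> 0"
  shows "bij_betw (mult_op c) laurent laurent"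
  by (rule bij_laurentI[of _ "mult_op (inverse c)"])
    (use assms in \<open>auto simp: mult_op_def mult.assoc[symmetric] intro: laurent_mult\<close>)

lemma bij_op_inv: "bij_betw Z laurent laurent \<Longrightarrow> bij_betw (op_inv Z) laurent laurent"
  unfolding op_inv_def by (rule bij_betw_inv_into)

lemma op_inv_comp:
  assumes "bij_betw Y laurent laurent" "bij_betw Z laurent laurent" "f \<in> laurent"
  shows "op_inv (Y \<circ> Z) f = op_inv Z (op_inv Y f)"
proof (rule op_inv_eqI)
  show "bij_betw (Y \<circ> Z) laurent laurent" using bij_betw_trans[OF assms(2,1)] .
  have 1: "op_inv Y f \<in> laurent" using bij_op_inv[OF assms(1)] assms(3) by (auto simp: bij_betw_def)
  then show "op_inv Z (op_inv Y f) \<in> laurent" using bij_op_inv[OF assms(2)] by (auto simp: bij_betw_def)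
  show "(Y \<circ> Z) (op_inv Z (op_inv Y f)) = f"
    using 1 assms unfolding op_inv_def by (simp add: bij_betw_inv_into_right)
qed

lemma op_inv_op_inv:
  assumes "bij_betw Z laurent laurent" "f \<in> laurent"
  shows "op_inv (op_inv Z) f = Z f"
  by (rule op_inv_eqI[OF bij_op_inv])
    (use assms in \<open>auto simp: op_inv_def bij_betw_def\<close>)

lemma op_inv_mult_op:
  assumes "c \<in> laurent" "inverse c \<in> laurent" "c \<noteq> 0" "f \<in> laurent"
  shows "op_inv (mult_op c) f = inverse c * f"
  by (rule op_inv_eqI[OF bij_mult_op])
    (use assms in \<open>auto simp: mult_op_def mult.assoc[symmetric] intro: laurent_mult\<close>)

lemma ch_op_scaled:
  assumes "bij_betw Z laurent laurent" "c \<in> range rconst" "c \<noteq> 0" "f \<in> laurent"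
  shows "ch_op (mult_op c \<circ> Z) f = c * Z f + op_inv Z (inverse c * f)"
proof -
  have c: "c \<in> laurent" "inverse c \<in> laurent" using assms(2) by (simp_all only: laurent_simps)
  show ?thesis
    using op_inv_comp[OF bij_mult_op[OF c assms(3)] assms(1,4)] op_inv_mult_op[OF c assms(3,4)]
    by (simp add: ch_op_def mult_op_def)
qed

lemma ch_op_comp:
  assumes "bij_betw Y laurent laurent" "bij_betw Z laurent laurent" "f \<in> laurent"
  shows "ch_op (Y \<circ> Z) f = Y (Z f) + op_inv Z (op_inv Y f)"
  by (simp add: ch_op_def op_inv_comp[OF assms])

text \<open>
  Both kinds of dual operators are handled at once: their inverses are expressed by Z itself, so
  only one inverse of Z occurs in the operator ch of a dual.
\<close>

lemma bij_dual:
  assumes "bij_betw Z laurent laurent"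
  shows "bij_betw (mult_op (inverse x) \<circ> op_inv Z) laurent laurent"
    "bij_betw (mult_op (qpow (- 2)) \<circ> op_inv Z \<circ> mult_op x) laurent laurent"
proof -
  have "bij_betw (mult_op (inverse x)) laurent laurent" "bij_betw (mult_op x) laurent laurent"
    "bij_betw (mult_op (qpow (- 2))) laurent laurent"
    by (rule bij_mult_op; simp add: laurent_simps qpow_numerals)+
  then show "bij_betw (mult_op (inverse x) \<circ> op_inv Z) laurent laurent"
    "bij_betw (mult_op (qpow (- 2)) \<circ> op_inv Z \<circ> mult_op x) laurent laurent"
    using bij_op_inv[OF assms] by (meson bij_betw_trans)+
qed

lemma op_inv_dual:
  assumes "bij_betw Z laurent laurent" "f \<in> laurent"
  shows "op_inv (mult_op (inverse x) \<circ> op_inv Z) f = Z (x * f)"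
    "op_inv (mult_op (qpow (- 2)) \<circ> op_inv Z \<circ> mult_op x) f = inverse x * Z (p * f)"
proof -
  have b: "bij_betw (mult_op (inverse x)) laurent laurent" "bij_betw (mult_op x) laurent laurent"
    "bij_betw (mult_op (qpow (- 2))) laurent laurent"
    by (rule bij_mult_op; simp add: laurent_simps qpow_numerals)+
  note c = bij_op_inv[OF assms(1)]
  have m: "op_inv (mult_op (inverse x)) f = x * f" "op_inv (mult_op (qpow (- 2))) f = p * f"
    by (subst op_inv_mult_op; simp add: laurent_simps qpow_numerals assms)+
  have l: "x * f \<in> laurent" "p * f \<in> laurent" by (simp_all only: laurent_simps assms)
  have Z: "Z (p * f) \<in> laurent" using l assms by (auto simp: bij_betw_def)
  show "op_inv (mult_op (inverse x) \<circ> op_inv Z) f = Z (x * f)"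
    by (simp only: op_inv_comp[OF b(1) c assms(2)] m op_inv_op_inv[OF assms(1) l(1)])
  have "op_inv (mult_op (qpow (- 2)) \<circ> op_inv Z \<circ> mult_op x) f = op_inv (mult_op x) (Z (p * f))"
    by (simp only: op_inv_comp[OF bij_betw_trans[OF c b(3)] b(2) assms(2)] op_inv_comp[OF b(3) c assms(2)] m
       op_inv_op_inv[OF assms(1) l(2)])
  then show "op_inv (mult_op (qpow (- 2)) \<circ> op_inv Z \<circ> mult_op x) f = inverse x * Z (p * f)"
    by (simp add: op_inv_mult_op[OF laurent_x x_nz Z])
qed

lemma ch_op_dual:
  assumes "bij_betw Z laurent laurent" "f \<in> laurent"
  shows "ch_op (mult_op im \<circ> (mult_op (inverse x) \<circ> op_inv Z)) f
      = im * inverse x * op_inv Z f + Z (- im * x * f)"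
    "ch_op (mult_op im \<circ> (mult_op (qpow (- 2)) \<circ> op_inv Z \<circ> mult_op x)) f
      = im * inverse p * op_inv Z (x * f) + inverse x * Z (- im * p * f)"
proof -
  have "- im * f \<in> laurent" by (simp only: laurent_simps assms)
  note d = op_inv_dual[OF assms(1) this]
  note c = ch_op_scaled[OF bij_dual(1)[OF assms(1)] const_generators(2) im_nz assms(2)]
     ch_op_scaled[OF bij_dual(2)[OF assms(1)] const_generators(2) im_nz assms(2)]
  show "ch_op (mult_op im \<circ> (mult_op (inverse x) \<circ> op_inv Z)) f
      = im * inverse x * op_inv Z f + Z (- im * x * f)"
    "ch_op (mult_op im \<circ> (mult_op (qpow (- 2)) \<circ> op_inv Z \<circ> mult_op x)) f
      = im * inverse p * op_inv Z (x * f) + inverse x * Z (- im * p * f)"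
    unfolding c inverse_im d by (simp_all add: mult_op_def mult_ac qpow_numerals)
qed

section \<open>Hecke operators\<close>

text \<open>
  The square of Z is (A^2 + B \<phi>(B)) + B (A + \<phi>(A)) \<phi>, and the two conditions say that this is
  1 + \<tau> (A + B \<phi>).
\<close>

lemma reflection_operator_quadratic:
  assumes "field_embedding \<phi>" "\<And>f. \<phi> (\<phi> f) = f"
    and Z: "\<And>f. Z f = A * f + B * \<phi> f"
    and "A + \<phi> A = \<tau>" "B * \<phi> B - A * \<phi> A = 1"
  shows "Z (Z f) = f + \<tau> * Z f"
proof -
  interpret field_embedding \<phi> by fact
  have "Z (Z f) = (A\<^sup>2 + B * \<phi> B) * f + B * (A + \<phi> A) * \<phi> f"
    by (simp add: Z add mult assms(2) algebra_simps power2_eq_square)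
  also have "A\<^sup>2 + B * \<phi> B = 1 + \<tau> * A"
    using assms(4,5) by (simp add: algebra_simps power2_eq_square flip: assms(4))
  finally show ?thesis
    by (simp add: assms(4) Z algebra_simps)
qed

lemma T0_T0: "T0 (T0 f) = f - im * ch x0 * T0 f"
proof -
  define A where "A = im * (x / (p - x)) * ch x0"
  define B where "B = - (im * (x / (p - x)) * ((p + x * x0\<^sup>2) / (x * x0)))"
  have A': "\<sigma> A = - (im * (p / (p - x)) * ch x0)"
    using x_neq by (simp add: A_def ch_def hom_simps qpow_numerals divide_simps)
       (simp add: algebra_simps power2_eq_square)
  have B': "\<sigma> B = im * ((x + p * x0\<^sup>2) / (x0 * (p - x)))"
    using x_neq by (simp add: B_def hom_simps qpow_numerals divide_simps)
       (simp add: algebra_simps power2_eq_square)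
  have "T0 (T0 f) = f + (- (im * ch x0)) * T0 f"
  proof (rule reflection_operator_quadratic[of "\<lambda>f. \<sigma> f" T0 A B])
    show "T0 f = A * f + B * \<sigma> f" for f
      by (simp add: T0_def A_def B_def ch_def algebra_simps)
    show "A + \<sigma> A = - (im * ch x0)"
      unfolding A' using x_neq by (simp add: A_def divide_simps) (simp add: algebra_simps)
    have "B * \<sigma> B - A * \<sigma> A = - (im * im) *
      ((p + x * x0\<^sup>2) * (x + p * x0\<^sup>2) / (x0\<^sup>2 * (p - x)\<^sup>2) - p * x * (ch x0)\<^sup>2 / (p - x)\<^sup>2)"
      unfolding A' B' by (simp add: A_def B_def power2_eq_square) (simp add: algebra_simps)
    also have "\<dots> = 1"
      using x_neq by (simp add: im_im ch_def divide_simps) (simp add: algebra_simps power2_eq_square)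
    finally show "B * \<sigma> B - A * \<sigma> A = 1" .
  qed (simp_all add: sigma_sigma sigma.field_embedding_axioms del: s_s)
  then show ?thesis by simp
qed

lemma T1_T1: "T1 (T1 f) = f - (t1 - inverse t1) * T1 f"
proof -
  define c where "c = im * ((1 + p * x) / (p * (1 - x\<^sup>2)) * ((p * x + x1\<^sup>2) / x1))"
  define k where "k = im * p / x1"
  have s1: "c + s c = im * (x1 / p - p / x1)"
    using x_neq by (simp add: c_def hom_simps divide_simps) (simp add: algebra_simps power2_eq_square)
  have "T1 (T1 f) = f + (- (t1 - inverse t1)) * T1 f"
  proof (rule reflection_operator_quadratic[of s T1 "- c - k" c])
    show "T1 f = (- c - k) * f + c * s f" for f
      by (simp add: T1_def c_def k_def algebra_simps divide_inverse)
    have "- c - k + s (- c - k) = - (c + s c) - 2 * k"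
      by (simp add: hom_simps k_def)
    also have "\<dots> = - (t1 - inverse t1)"
      unfolding s1 by (simp add: k_def t1_def qpow_numerals inverse_im divide_inverse algebra_simps)
    finally show "- c - k + s (- c - k) = - (t1 - inverse t1)" .
    have "s k = k"
      by (simp add: hom_simps k_def)
    then have "c * s c - (- c - k) * s (- c - k) = - k * (c + s c) - k * k"
      by (simp add: hom_simps algebra_simps)
    also have "\<dots> = 1"
      unfolding s1 by (simp add: k_def right_diff_distrib mult.assoc) (simp add: im_im algebra_simps add_divide_distrib flip: mult.assoc)
    finally show "c * s c - (- c - k) * s (- c - k) = 1" .
  qed (simp_all add: s.field_embedding_axioms)
  then show ?thesis by (simp add: algebra_simps)
qed

text \<open>
  The formula for T_0 f below removes the denominator p - x: as a multiple of f plus a multiple of the divided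
  difference, its coefficients are Laurent polynomials.  The same is done for T_1 and, later, for U_0 and U_1.
\<close>

lemma T0_laurent:
  assumes "f \<in> laurent" shows "T0 f \<in> laurent"
proof -
  have "T0 f = - im * inverse x0 * f - im * inverse x0 * (p + x * x0\<^sup>2) * ((\<sigma> f - f) / (p - x))"
    using x_neq by (simp add: T0_def divide_simps) (simp add: algebra_simps power2_eq_square)
  also have "\<dots> \<in> laurent"
    by (simp only: laurent_simps assms laurent_divided_difference_sigma)
  finally show ?thesis .
qed

lemma T1_laurent:
  assumes "f \<in> laurent" shows "T1 f \<in> laurent"
proof -
  have "T1 f = im * inverse x1 * inverse p * ((1 + p * x) * (p * x + x1\<^sup>2) * ((s f - f) / (1 - x\<^sup>2)) - p\<^sup>2 * f)"
    using x_neq by (simp add: T1_def divide_simps) (simp add: algebra_simps power2_eq_square)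
  also have "\<dots> \<in> laurent"
    by (simp only: laurent_simps assms laurent_divided_difference_s)
  finally show ?thesis .
qed

lemma T0_linear: "T0 (f + g) = T0 f + T0 g" "T0 (f - g) = T0 f - T0 g"
  "c \<in> range rconst \<Longrightarrow> T0 (c * f) = c * T0 f"
proof -
  obtain A B where "\<And>f. T0 f = A * (B * \<sigma> f + (x0 + inverse x0) * f)"
    unfolding T0_def by blast
  then show "T0 (f + g) = T0 f + T0 g" "T0 (f - g) = T0 f - T0 g"
    "c \<in> range rconst \<Longrightarrow> T0 (c * f) = c * T0 f"
    by (simp_all add: hom_simps s_const eth_const algebra_simps)
qed

lemma T1_linear: "T1 (f + g) = T1 f + T1 g" "T1 (f - g) = T1 f - T1 g"
  "c \<in> range rconst \<Longrightarrow> T1 (c * f) = c * T1 f"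
proof -
  obtain A B where T1: "\<And>f. T1 f = im * (A * (s f - f) - B * f)"
    unfolding T1_def by blast
  show "T1 (f + g) = T1 f + T1 g" "T1 (f - g) = T1 f - T1 g"
    "c \<in> range rconst \<Longrightarrow> T1 (c * f) = c * T1 f"
    unfolding T1 by (simp_all add: hom_simps s_const algebra_simps)
qed

lemma T0_inverse:
  shows T0_right: "T0 (T0 f + im * ch x0 * f) = f" and T0_left: "T0 (T0 f) + im * ch x0 * T0 f = f"
  by (simp_all add: T0_linear T0_T0 const_ch_t1 const_intros)

lemma T1_inverse:
  shows T1_right: "T1 (T1 f + (t1 - inverse t1) * f) = f"
    and T1_left: "T1 (T1 f) + (t1 - inverse t1) * T1 f = f"
  by (simp_all add: T1_linear T1_T1 const_ch_t1 const_intros)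

lemma bij_T0: "bij_betw T0 laurent laurent"
  by (rule bij_laurentI[of _ "\<lambda>f. T0 f + im * ch x0 * f"])
    (simp_all only: T0_inverse T0_laurent laurent_simps)

lemma bij_T1: "bij_betw T1 laurent laurent"
  by (rule bij_laurentI[of _ "\<lambda>f. T1 f + (t1 - inverse t1) * f"])
    (simp_all only: T1_inverse T1_laurent laurent_simps)

lemma op_inv_T0: "f \<in> laurent \<Longrightarrow> op_inv T0 f = T0 f + im * ch x0 * f"
  by (rule op_inv_eqI[OF bij_T0 _ T0_right]) (simp only: T0_laurent laurent_simps)

lemma op_inv_T1: "f \<in> laurent \<Longrightarrow> op_inv T1 f = T1 f + (t1 - inverse t1) * f"
  by (rule op_inv_eqI[OF bij_T1 _ T1_right]) (simp only: T1_laurent laurent_simps)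

text \<open>
  The image of the idempotent is symmetric because t_1 + T_1 = c s + s(c), with c the coefficient of s in T_1.
\<close>

lemma s_idem: "s (idem f) = idem f"
proof -
  define c where "c = im * ((1 + p * x) / (p * (1 - x\<^sup>2)) * ((p * x + x1\<^sup>2) / x1))"
  have 1: "t1 * f + T1 f = c * s f + s c * f"
    using x_neq by (simp add: T1_def t1_def c_def hom_simps qpow_numerals divide_simps)
      (simp add: algebra_simps power_numeral_reduce)
  have "s (t1 * f + T1 f) = t1 * f + T1 f"
    unfolding 1 by (simp add: hom_simps add.commute)
  moreover have "s t1 = t1" by (simp add: t1_def hom_simps)
  ultimately show ?thesis by (simp add: idem_def hom_simps)
qed

lemma idem_laurent: "f \<in> laurent \<Longrightarrow> idem f \<in> laurent"
  unfolding idem_def by (simp only: laurent_simps T1_laurent)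

text \<open>
  On symmetric polynomials T_1 acts as the scalar 1 / t_1.
  The value on x f is needed for the dual operator, whose inverse is T_1 x.
\<close>

lemma T1_symmetric:
  assumes "s f = f"
  shows "T1 f = inverse t1 * f" "T1 (x * f) = im * inverse x1 * (1 + x1\<^sup>2 / (p * x) + x1\<^sup>2) * f"
   by (simp add: T1_def t1_def assms qpow_numerals inverse_im divide_inverse)
     (use x_neq in \<open>simp add: T1_def hom_simps assms divide_simps\<close>, simp add: algebra_simps power_numeral_reduce)

lemma op_inv_T1_symmetric:
  assumes "f \<in> laurent" "s f = f"
  shows "op_inv T1 f = t1 * f"
  unfolding op_inv_T1[OF assms(1)] T1_symmetric(1)[OF assms(2)] by (simp add: algebra_simps)

section \<open>Ladder operators\<close>

text \<open>
  K_0 and G_0 differ only in the coefficient of the lowering shift; the operator with an arbitrary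
  coefficient z in this place makes their products comparable.
\<close>

definition ladder :: "nat \<Rightarrow> K \<Rightarrow> oper" where
  "ladder b z f = (z * ethb b (- 1) f - ethb b 1 f) / (1 - (xb b)\<^sup>2)"

definition K_coeff :: "nat \<Rightarrow> K \<Rightarrow> K" where
  "K_coeff b y = (p * y + (xb b)\<^sup>2) * (p ^ 3 * y + (xb b)\<^sup>2) / (p\<^sup>2 * y)"

definition G_coeff :: "nat \<Rightarrow> K" where
  "G_coeff b = (p * x + (xb b)\<^sup>2) * (p + x * (xb b)\<^sup>2) / (p * x)"

lemma K0_ladder: "K0 b y = ladder b (K_coeff b y)"
  by (simp add: K0_def ladder_def K_coeff_def fun_eq_iff qpow_numerals diff_divide_distrib)

lemma G0_ladder: "G0 b x = ladder b (G_coeff b)"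
  by (simp add: G0_def ladder_def G_coeff_def fun_eq_iff qpow_numerals diff_divide_distrib)

lemma ladder_add: "ladder b z (f + g) = ladder b z f + ladder b z g"
  and ladder_diff: "ladder b z (f - g) = ladder b z f - ladder b z g"
  by (simp_all add: ladder_def hom_simps algebra_simps diff_divide_distrib add_divide_distrib)

lemma ladder_mult:
  assumes "ethb b 1 c = c" "ethb b (- 1) c = c"
  shows "ladder b z (c * f) = c * ladder b z f"
  by (simp add: ladder_def hom_simps assms algebra_simps)

lemma s_ladder: "s (ladder b z f) = ladder b (s z) (s f)"
  by (simp add: ladder_def hom_simps ethb_s)

lemma eth_ladder: "eth e (ladder b z f) = ladder b (eth e z) (eth e f)"
  by (simp add: ladder_def hom_simps ethb_eth)

lemma ladder_ladder:
  "ladder b z (ladder b w f) =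
    (ethb b 2 f / (1 - p\<^sup>2 * (xb b)\<^sup>2)
      - (ethb b 1 w / (1 - p\<^sup>2 * (xb b)\<^sup>2) + z / (1 - (xb b)\<^sup>2 / p\<^sup>2)) * f
      + z * ethb b (- 1) w / (1 - (xb b)\<^sup>2 / p\<^sup>2) * ethb b (- 2) f) / (1 - (xb b)\<^sup>2)"
  by (simp add: ladder_def hom_simps ethb_ethb qpow_numerals power_mult_distrib power_inverse)
    (simp add: divide_inverse algebra_simps)

text \<open>
  In a product of two ladder operators the coefficient of the twofold raising shift is always the same, so
  two products agree up to a multiple of the identity if the coefficients of the twofold lowering shift agree
  and those of the identity differ by d.
\<close>

lemma ladder_eqI:
  assumes "z * ethb b (- 1) w = z' * ethb b (- 1) w'"
    and "ethb b 1 w / (1 - p\<^sup>2 * (xb b)\<^sup>2) + z / (1 - (xb b)\<^sup>2 / p\<^sup>2)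
      = ethb b 1 w' / (1 - p\<^sup>2 * (xb b)\<^sup>2) + z' / (1 - (xb b)\<^sup>2 / p\<^sup>2) + d * (1 - (xb b)\<^sup>2)"
  shows "ladder b z (ladder b w f) = ladder b z' (ladder b w' f) - d * f"
proof -
  have "1 - (xb b)\<^sup>2 \<noteq> 0" using xb_sq_neq[of b] by simp
  then show ?thesis
    unfolding ladder_ladder assms by (simp add: divide_simps) (simp add: algebra_simps)
qed

lemma ladder_laurent: "z \<in> laurent \<Longrightarrow> f \<in> laurent \<Longrightarrow> ladder b z f \<in> laurent"
  unfolding ladder_def by (simp only: laurent_simps laurent_ethb)

lemma K_coeff_laurent: "K_coeff b x \<in> laurent" "K_coeff b (inverse x) \<in> laurent" and G_coeff_laurent: "G_coeff b \<in> laurent"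
proof -
  have "K_coeff b x = (p * x + (xb b)\<^sup>2) * (p ^ 3 * x + (xb b)\<^sup>2) * inverse (p\<^sup>2) * inverse x"
    "K_coeff b (inverse x) = (p * inverse x + (xb b)\<^sup>2) * (p ^ 3 * inverse x + (xb b)\<^sup>2) * inverse (p\<^sup>2) * x"
    "G_coeff b = (p * x + (xb b)\<^sup>2) * (p + x * (xb b)\<^sup>2) * inverse p * inverse x"
    by (simp_all add: K_coeff_def G_coeff_def divide_inverse mult_ac)
  then show "K_coeff b x \<in> laurent" "K_coeff b (inverse x) \<in> laurent" "G_coeff b \<in> laurent"
    by (simp_all only: laurent_simps)
qed

lemma G0_laurent: "f \<in> laurent \<Longrightarrow> G0 b x f \<in> laurent"
  unfolding G0_ladder by (intro ladder_laurent G_coeff_laurent)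

abbreviation up :: oper where "up \<equiv> ethb 1 1"

abbreviation dn :: oper where "dn \<equiv> ethb 1 (- 1)"

lemma ladder_ethb:
  assumes "\<And>e. ethb 1 e z = z"
  shows "ladder 0 z (ethb 1 e f) = ethb 1 e (ladder 0 z f)"
  by (simp only: ladder_def hom_simps assms ethb_1_ethb_0) simp

lemma ladder_commute:
  assumes "\<And>e. ethb 1 e z = z" "\<And>e. ethb 0 e w = w"
  shows "ladder 0 z (ladder 1 w f) = ladder 1 w (ladder 0 z f)"
proof -
  have 1: "ladder 1 w g = inverse (1 - x1\<^sup>2) * (w * dn g - up g)" for g
    by (simp only: ladder_def divide_inverse mult.commute)
  have "ladder 0 z (ladder 1 w f) = ladder 0 z (inverse (1 - x1\<^sup>2) * (w * dn f - up f))"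
    by (simp only: 1)
  also have "\<dots> = inverse (1 - x1\<^sup>2) * (w * ladder 0 z (dn f) - ladder 0 z (up f))"
    by (subst ladder_mult; (subst ladder_diff ladder_mult)?; simp add: hom_simps assms ladder_diff ladder_mult)
  also have "\<dots> = ladder 1 w (ladder 0 z f)"
    by (simp only: ladder_ethb[OF assms(1)] 1)
  finally show ?thesis .
qed

lemma coeff_fixed: "ethb 1 e (K_coeff 0 x) = K_coeff 0 x" "ethb 1 e (K_coeff 0 (inverse x)) = K_coeff 0 (inverse x)" "ethb 1 e (G_coeff 0) = G_coeff 0"
  "ethb 0 e (K_coeff 1 x) = K_coeff 1 x" "ethb 0 e (K_coeff 1 (inverse x)) = K_coeff 1 (inverse x)" "ethb 0 e (G_coeff 1) = G_coeff 1"
  by (simp_all add: K_coeff_def G_coeff_def hom_simps)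

section \<open>The operator U0\<close>

abbreviation \<K> :: oper where "\<K> \<equiv> K0 0 (inverse x)"

abbreviation \<G> :: oper where "\<G> \<equiv> G0 0 x"

lemma one_minus_quotient: "1 - (xb b)\<^sup>2 / p\<^sup>2 = (p\<^sup>2 - (xb b)\<^sup>2) / p\<^sup>2"
  by (simp add: divide_simps)

text \<open>
  By \<open>ladder_eqI\<close> this and the next relation reduce to two identities between coefficients each.  The one for the
  twofold lowering shift holds because \<sigma> and the lowering shift permute the linear factors p x + x_0^2, p + x x_0^2 and p^3 + x x_0^2 of the coefficients up to
  powers of p and x: both send, for instance, one of the first two to a multiple of the third.
\<close>

lemma K_sigma_G: "\<K> (\<sigma> (\<G> f)) = \<G> (\<K> (\<sigma> f))"
proof -
  have "ladder 0 (K_coeff 0 (inverse x)) (ladder 0 (\<sigma> (G_coeff 0)) (\<sigma> f))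
      = ladder 0 (G_coeff 0) (ladder 0 (K_coeff 0 (inverse x)) (\<sigma> f)) - 0 * \<sigma> f"
  proof (rule ladder_eqI)
    show "K_coeff 0 (inverse x) * ethb 0 (- 1) (\<sigma> (G_coeff 0)) = G_coeff 0 * ethb 0 (- 1) (K_coeff 0 (inverse x))"
      by (simp add: K_coeff_def G_coeff_def hom_simps qpow_numerals divide_simps)
        (simp add: algebra_simps power_numeral_reduce)
    show "ethb 0 1 (\<sigma> (G_coeff 0)) / (1 - p\<^sup>2 * x0\<^sup>2) + K_coeff 0 (inverse x) / (1 - x0\<^sup>2 / p\<^sup>2) =
      ethb 0 1 (K_coeff 0 (inverse x)) / (1 - p\<^sup>2 * x0\<^sup>2) + G_coeff 0 / (1 - x0\<^sup>2 / p\<^sup>2) + 0 * (1 - x0\<^sup>2)"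
      using xb_sq_neq[of 0]
      by (simp add: one_minus_quotient K_coeff_def G_coeff_def hom_simps qpow_numerals divide_simps)
        (simp add: algebra_simps power_numeral_reduce)
  qed
  then show ?thesis
    by (simp add: K0_ladder G0_ladder s_ladder eth_ladder)
qed

lemma K_sigma_K: "\<K> (\<sigma> (\<K> (\<sigma> f))) = \<G> (\<G> f) - (p - x)\<^sup>2 / x * f"
proof -
  have "ladder 0 (K_coeff 0 (inverse x)) (ladder 0 (\<sigma> (K_coeff 0 (inverse x))) f)
      = ladder 0 (G_coeff 0) (ladder 0 (G_coeff 0) f) - (p - x)\<^sup>2 / x * f"
  proof (rule ladder_eqI)
    show "K_coeff 0 (inverse x) * ethb 0 (- 1) (\<sigma> (K_coeff 0 (inverse x))) = G_coeff 0 * ethb 0 (- 1) (G_coeff 0)"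
      by (simp add: K_coeff_def G_coeff_def hom_simps qpow_numerals divide_simps)
        (simp add: algebra_simps power_numeral_reduce)
    show "ethb 0 1 (\<sigma> (K_coeff 0 (inverse x))) / (1 - p\<^sup>2 * x0\<^sup>2) + K_coeff 0 (inverse x) / (1 - x0\<^sup>2 / p\<^sup>2) =
      ethb 0 1 (G_coeff 0) / (1 - p\<^sup>2 * x0\<^sup>2) + G_coeff 0 / (1 - x0\<^sup>2 / p\<^sup>2) + (p - x)\<^sup>2 / x * (1 - x0\<^sup>2)"
      using xb_sq_neq[of 0]
      by (simp add: one_minus_quotient K_coeff_def G_coeff_def hom_simps qpow_numerals divide_simps)
        (simp add: algebra_simps power_numeral_reduce)
  qed
  then show ?thesis
    by (simp add: K0_ladder G0_ladder s_ladder eth_ladder) (simp add: s_eth eth_eth)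
qed

text \<open>
  U_0 is this factor times (K \<sigma> - G).  Its trace u + \<sigma>(u) is - q^(-1/4), and its norm u \<sigma>(u) cancels
  the function (p - x)^2 / x that appears in the square of K \<sigma>.
\<close>

definition U0_factor :: K where "U0_factor = x / (r * (p - x))"

lemma sigma_U0_factor: "\<sigma> U0_factor = - p / (r * (p - x))"
  using x_neq by (simp add: U0_factor_def hom_simps qpow_numerals divide_simps)
      (simp add: algebra_simps power_numeral_reduce)

lemma U0_factor_sum: "U0_factor + inverse r = - \<sigma> U0_factor" "\<sigma> U0_factor + inverse r = - U0_factor"
  unfolding sigma_U0_factor using x_neq by (simp_all add: U0_factor_def divide_simps)

lemma U0_factor_norm: "U0_factor * \<sigma> U0_factor * ((p - x)\<^sup>2 / x) = - 1"
  unfolding sigma_U0_factor using x_neq by (simp add: U0_factor_def divide_simps)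
      (simp add: p_r algebra_simps power_numeral_reduce)

lemma U0_factored: "U0 f = U0_factor * (\<K> (\<sigma> f) - \<G> f)"
proof -
  have "qpow (- 1) * x / (p - x) = U0_factor"
    by (simp add: U0_factor_def qpow_numerals divide_inverse mult_ac)
  then show ?thesis
    by (simp only: U0_def right_diff_distrib)
qed

lemma U0_factor_fixed [simp]: "ethb b e U0_factor = U0_factor" "ethb b e (\<sigma> U0_factor) = \<sigma> U0_factor"
  unfolding sigma_U0_factor by (simp_all add: U0_factor_def hom_simps)

lemma KG_additive: "\<K> (f + g) = \<K> f + \<K> g" "\<G> (f + g) = \<G> f + \<G> g" "\<K> (f - g) = \<K> f - \<K> g" "\<G> (f - g) = \<G> f - \<G> g"
  by (simp_all add: K0_ladder G0_ladder ladder_diff ladder_add)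

lemma KG_factor: "\<K> (U0_factor * f) = U0_factor * \<K> f" "\<G> (U0_factor * f) = U0_factor * \<G> f"
  "\<K> (\<sigma> U0_factor * f) = \<sigma> U0_factor * \<K> f" "\<G> (\<sigma> U0_factor * f) = \<sigma> U0_factor * \<G> f"
  unfolding K0_ladder G0_ladder by (rule ladder_mult; simp only: U0_factor_fixed)+

text \<open>
  As the trace of the factor is - 1 / r, subtracting G / r from U_0 replaces - u by \<sigma>(u) in front of G.
\<close>

lemma U0_inverse_expand: "U0 f - \<G> f / r = U0_factor * \<K> (\<sigma> f) + \<sigma> U0_factor * \<G> f"
proof -
  have "U0 f - \<G> f / r = U0_factor * \<K> (\<sigma> f) - (U0_factor + inverse r) * \<G> f"
    by (simp add: U0_factored algebra_simps divide_inverse)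
  then show ?thesis by (simp add: U0_factor_sum)
qed

text \<open>
  Since K \<sigma> and G commute, both products of U_0 with the candidate reduce to
  u \<sigma>(u) ((K \<sigma>)^2 - G^2) = 1.
\<close>

lemma U0_right: "U0 (U0 f - \<G> f / r) = f"
proof -
  have "U0 (U0 f - \<G> f / r) = - (U0_factor * \<sigma> U0_factor * ((p - x)\<^sup>2 / x)) * f"
    unfolding U0_inverse_expand unfolding U0_factored
    by (simp only: sigma_ops KG_additive KG_factor K_sigma_K K_sigma_G sigma_sigma) (simp add: algebra_simps)
  then show ?thesis by (simp only: U0_factor_norm) simp
qed

lemma U0_left: "U0 (U0 f) - \<G> (U0 f) / r = f"
proof -
  have "U0 (U0 f) - \<G> (U0 f) / r = - (U0_factor * \<sigma> U0_factor * ((p - x)\<^sup>2 / x)) * f"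
    unfolding U0_inverse_expand unfolding U0_factored
    by (simp only: sigma_ops KG_additive KG_factor K_sigma_K K_sigma_G sigma_sigma) (simp add: algebra_simps)
  then show ?thesis by (simp only: U0_factor_norm) simp
qed

text \<open>
  At x = p the coefficients of K and G coincide: their difference is (p - x) Q.
  Together with \<sigma> f = f + (p - x) D this exposes the factor p - x of K \<sigma> f - G f.
\<close>

lemma U0_laurent:
  assumes "f \<in> laurent" shows "U0 f \<in> laurent"
proof -
  define D where "D = (\<sigma> f - f) / (p - x)"
  have f: "\<sigma> f = f + (p - x) * D"
    using x_neq by (simp add: D_def)
  have D: "D \<in> laurent" unfolding D_def by (rule laurent_divided_difference_sigma[OF assms])
  define Q where "Q = (p + x * x0\<^sup>2) * (p\<^sup>2 - x0\<^sup>2) / (p\<^sup>2 * x)"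
  have g: "G_coeff 0 = K_coeff 0 (inverse x) - (p - x) * Q"
    by (simp add: K_coeff_def G_coeff_def Q_def divide_simps)
      (simp add: algebra_simps power_numeral_reduce)
  have "ladder 0 (K_coeff 0 (inverse x)) (\<sigma> f) - ladder 0 (G_coeff 0) f =
    (p - x) * (ladder 0 (K_coeff 0 (inverse x)) D + Q * ethb 0 (-1) f / (1 - x0\<^sup>2))"
    unfolding f ladder_def g by (simp add: hom_simps algebra_simps diff_divide_distrib add_divide_distrib)
  moreover have "U0_factor * (p - x) = x * inverse r"
    using x_neq by (simp add: U0_factor_def divide_inverse mult_ac)
  ultimately have "U0 f = x * inverse r * (ladder 0 (K_coeff 0 (inverse x)) D + Q * ethb 0 (-1) f / (1 - x0\<^sup>2))"
    by (simp only: U0_factored K0_ladder G0_ladder mult.assoc[symmetric])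
  also have "x * inverse r * Q = inverse r * ((p + x * x0\<^sup>2) * (p\<^sup>2 - x0\<^sup>2) * inverse (p\<^sup>2))"
    by (simp add: Q_def divide_inverse mult_ac)
  then have "x * inverse r * (ladder 0 (K_coeff 0 (inverse x)) D + Q * ethb 0 (-1) f / (1 - x0\<^sup>2))
      = inverse r * (x * ladder 0 (K_coeff 0 (inverse x)) D
        + (p + x * x0\<^sup>2) * (p\<^sup>2 - x0\<^sup>2) * inverse (p\<^sup>2) * ethb 0 (-1) f / (1 - x0\<^sup>2))"
    by (simp add: distrib_left mult.assoc[symmetric])
  also have "\<dots> \<in> laurent"
    by (simp only: laurent_simps laurent_ethb assms D ladder_laurent K_coeff_laurent)
  finally show ?thesis .
qed

lemma bij_U0: "bij_betw U0 laurent laurent"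
  by (rule bij_laurentI[of _ "\<lambda>f. U0 f - \<G> f / r"])
    (simp_all only: U0_left U0_right U0_laurent G0_laurent laurent_simps)

lemma op_inv_U0: "f \<in> laurent \<Longrightarrow> op_inv U0 f = U0 f - \<G> f / r"
  by (rule op_inv_eqI[OF bij_U0 _ U0_right]) (simp only: U0_laurent G0_laurent laurent_simps)

section \<open>The operator U1\<close>

text \<open>
  The coefficient \<mu> arises as (G_coeff - p x K_coeff) / (1 - p x); the quotient is a Laurent polynomial,
  which is why U_1 has no pole at x = 1/p.
\<close>

definition mu :: K where "mu = (1 + p * x) * (p * x + x1\<^sup>2) / x"

lemma mu_laurent: "mu \<in> laurent"
proof -
  have "mu = (1 + p * x) * (p * x + x1\<^sup>2) * inverse x" by (simp add: mu_def divide_inverse)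
  also have "\<dots> \<in> laurent" by (simp only: laurent_simps)
  finally show ?thesis .
qed

lemma U1_expand:
  "U1 f = (mu * dn f - up f) * r / (1 - x1\<^sup>2) - x * (1 + p * x) / r * K0 1 x ((s f - f) / (1 - x\<^sup>2))"
proof -
  have 1: "K0 1 x ((s f - f) / (1 - x\<^sup>2)) = inverse (1 - x\<^sup>2) * K0 1 x (s f - f)"
    unfolding K0_ladder by (subst ladder_mult[symmetric]) (simp_all add: hom_simps divide_inverse mult_ac)
  have "G_coeff 1 - p * x * K_coeff 1 x = (1 - p * x) * mu"
    by (simp add: G_coeff_def K_coeff_def mu_def divide_simps)
      (simp add: algebra_simps power_numeral_reduce)
  then have G_coeff: "G_coeff 1 = p * x * K_coeff 1 x + (1 - p * x) * mu" by (simp add: algebra_simps)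
  have "G0 1 x f - p * x * K0 1 x f = (1 - p * x) * ((mu * dn f - up f) / (1 - x1\<^sup>2))"
    unfolding K0_ladder G0_ladder ladder_def G_coeff by (simp add: diff_divide_distrib add_divide_distrib algebra_simps)
  moreover have "U1 f = - (x * (1 + p * x) / (r * (1 - x\<^sup>2))) * K0 1 x (s f - f)
      + r / (1 - p * x) * (G0 1 x f - p * x * K0 1 x f)"
    by (simp only: U1_def qpow_numerals)
  moreover have "r / (1 - p * x) * ((1 - p * x) * ((mu * dn f - up f) / (1 - x1\<^sup>2)))
      = (mu * dn f - up f) * r / (1 - x1\<^sup>2)"
    using x_neq by simp
  moreover have "- (x * (1 + p * x) / (r * (1 - x\<^sup>2))) * K0 1 x (s f - f)
      = - (x * (1 + p * x) / r * (inverse (1 - x\<^sup>2) * K0 1 x (s f - f)))"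
    by (simp add: divide_inverse mult_ac)
  ultimately show ?thesis
    unfolding 1 by (simp only: diff_conv_add_uminus add.commute)
qed

lemma U1_linear: "U1 (f + g) = U1 f + U1 g" "U1 (f - g) = U1 f - U1 g"
proof -
  have "\<exists>A B C D. \<forall>f. U1 f = (mu * dn f - up f) * A / D - B * K0 1 x ((s f - f) / C)"
    by (intro exI allI) (rule U1_expand)
  then obtain A B C D where U1: "\<And>f. U1 f = (mu * dn f - up f) * A / D - B * K0 1 x ((s f - f) / C)"
    by blast
  show "U1 (f + g) = U1 f + U1 g"
    by (simp add: U1 K0_ladder hom_simps algebra_simps diff_divide_distrib add_divide_distrib ladder_add ladder_diff)
  show "U1 (f - g) = U1 f - U1 g"
    by (simp add: U1 K0_ladder hom_simps algebra_simps diff_divide_distrib add_divide_distrib ladder_add ladder_diff)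
qed

lemma U1_laurent:
  assumes "f \<in> laurent" shows "U1 f \<in> laurent"
proof -
  have "U1 f = (mu * dn f - up f) * r / (1 - x1\<^sup>2)
      - x * (1 + p * x) * inverse r * ladder 1 (K_coeff 1 x) ((s f - f) / (1 - x\<^sup>2))"
    unfolding U1_expand K0_ladder by (simp add: divide_inverse)
  also have "mu = (1 + p * x) * (p * x + x1\<^sup>2) * inverse x"
    by (simp add: mu_def divide_inverse)
  finally show ?thesis
    by (simp only: laurent_simps laurent_ethb assms laurent_divided_difference_s ladder_laurent K_coeff_laurent)
qed

lemma U1_symmetric_pair:
  assumes "s f = f" "s g = g"
  shows "U1 (f + x * g) = (up (g - p * f) + mu * (p * dn f - x1\<^sup>2 / p\<^sup>2 * dn g)) / (r * (1 - x1\<^sup>2))"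
proof -
  have d: "(s (f + x * g) - (f + x * g)) / (1 - x\<^sup>2) = inverse x * g"
    using x_neq by (simp add: hom_simps assms divide_simps) (simp add: algebra_simps power2_eq_square)
  have K: "K0 1 x (inverse x * g) = inverse x * K0 1 x g"
    unfolding K0_ladder by (rule ladder_mult) (simp_all add: hom_simps)
  show ?thesis
    unfolding U1_expand d K unfolding K0_ladder ladder_def K_coeff_def mu_def using xb_sq_neq[of 1]
    by (simp add: hom_simps p_r divide_simps)
      (simp add: algebra_simps power_numeral_reduce)
qed

text \<open>Applying s and subtracting leaves (\<mu> - s(\<mu>)) g = 0, and \<mu> is not symmetric since x_1^2 \<noteq> q.\<close>

lemma symmetric_mu_independent:
  assumes "s f = f" "s g = g" "f + mu * g = 0"
  shows "f = 0" "g = 0"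
proof -
  have "s (f + mu * g) = 0"
    by (simp only: assms(3) s.zero)
  then have "f + s mu * g = 0"
    by (simp only: s.add s.mult assms(1,2))
  moreover have "(mu - s mu) * g = (f + mu * g) - (f + s mu * g)"
    by (simp add: algebra_simps)
  ultimately have "(mu - s mu) * g = 0"
    by (simp only: assms(3) diff_self)
  moreover have "mu - s mu = (p\<^sup>2 - x1\<^sup>2) * (x\<^sup>2 - 1) / x"
    by (simp add: mu_def hom_simps divide_simps)
      (simp add: algebra_simps power_numeral_reduce)
  ultimately show "g = 0"
    using x_neq xb_sq_neq[of 1] by simp
  then show "f = 0" using assms(3) by simp
qed

lemma inj_U1: "inj_on U1 laurent"
proof (rule inj_onI)
  fix f g assume fg: "f \<in> laurent" "g \<in> laurent" "U1 f = U1 g"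
  from fg obtain h k where hk: "f - g = h + x * k" "s h = h" "s k = k"
    using symmetric_pair[OF laurent_diff] by metis
  have "U1 (f - g) = 0" using fg by (simp add: U1_linear)
  then have z: "up (k - p * h) + mu * (p * dn h - x1\<^sup>2 / p\<^sup>2 * dn k) = 0"
    using xb_sq_neq[of 1] unfolding hk(1) U1_symmetric_pair[OF hk(2,3)] by simp
  have "up (k - p * h) = 0" and 2: "p * dn h - x1\<^sup>2 / p\<^sup>2 * dn k = 0"
    by (rule symmetric_mu_independent[OF _ _ z]; simp add: hom_simps hk symmetric_ops del: ethb.eq_0_iff)+
  then have k: "k = p * h" by simp
  have "p * dn h * (p\<^sup>2 - x1\<^sup>2) = p\<^sup>2 * (p * dn h - x1\<^sup>2 / p\<^sup>2 * dn k)"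
    by (simp add: k hom_simps algebra_simps)
  also note 2
  finally have "dn h = 0" using xb_sq_neq[of 1] by simp
  then have "h = 0" by simp
  with hk k show "f = g" by simp
qed

text \<open>
  To solve U_1 (k_1 + x k_2) = f, first write f = h_1 + \<mu> h_2 with symmetric h_1 and h_2; this is possible
  because \<mu> = (p^2 - x_1^2) x plus a symmetric term.  Comparing with \<open>U1_symmetric_pair\<close> leaves two linear
  equations k_2 - p k_1 = A and p k_1 - x_1^2 k_2 = B, whose determinant is a multiple of 1 - x_1^2.
\<close>

lemma U1_surj:
  assumes "f \<in> laurent"
  obtains g where "g \<in> laurent" "U1 g = f"
proof -
  obtain g h where gh: "f = g + x * h" "s g = g" "s h = h" "g \<in> laurent" "h \<in> laurent"
    using symmetric_pair[OF assms] by metis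
  define h2 where "h2 = h / (p\<^sup>2 - x1\<^sup>2)"
  define h1 where "h1 = f - mu * h2"
  have h2: "s h2 = h2" by (simp add: h2_def hom_simps gh)
  \<comment> \<open>subtracting \<mu> h2 removes the part x h of f up to a symmetric remainder\<close>
  have "h1 = g - (p * (1 + x1\<^sup>2) + x1\<^sup>2 * (x + inverse x)) * h2"
    using xb_sq_neq[of 1]
    by (simp add: h1_def gh h2_def mu_def divide_simps)
      (simp add: algebra_simps power_numeral_reduce)
  then have h1: "s h1 = h1" by (simp add: hom_simps gh h2 add.commute)
  \<comment> \<open>the right-hand sides of the two equations, freed from the shifts\<close>
  define A where "A = r * (1 - x1\<^sup>2 / p\<^sup>2) * dn h1"
  define B where "B = r * (1 - p\<^sup>2 * x1\<^sup>2) * up h2"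
  define k2 where "k2 = (A + B) / (1 - x1\<^sup>2)"
  define k1 where "k1 = (k2 - A) / p"
  have s: "s A = A" "s B = B" by (simp_all add: A_def B_def hom_simps symmetric_ops h1 h2)
  then have s2: "s k1 = k1" "s k2 = k2" by (simp_all add: k1_def k2_def hom_simps)
  have "k2 - p * k1 = A" by (simp add: k1_def)
  then have 1: "up (k2 - p * k1) = r * (1 - x1\<^sup>2) * h1"
    by (simp add: A_def hom_simps ethb_inverse qpow_numerals power_mult_distrib)
  have "B = p * k1 - x1\<^sup>2 * k2"
    using xb_sq_neq[of 1] by (simp add: k1_def k2_def divide_simps) (simp add: algebra_simps)
  then have "dn B = dn (p * k1 - x1\<^sup>2 * k2)" by simp
  then have 2: "p * dn k1 - x1\<^sup>2 / p\<^sup>2 * dn k2 = r * (1 - x1\<^sup>2) * h2"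
    by (simp add: B_def hom_simps ethb_inverse qpow_numerals power_mult_distrib divide_inverse power_inverse mult_ac)
  have "U1 (k1 + x * k2) = h1 + mu * h2"
    unfolding U1_symmetric_pair[OF s2] 1 2 using xb_sq_neq[of 1]
    by (simp add: divide_simps) (simp add: algebra_simps)
  then have "U1 (k1 + x * k2) = f" by (simp add: h1_def)
  moreover have "k1 + x * k2 \<in> laurent"
  proof -
    have "h2 \<in> laurent" unfolding h2_def by (simp only: laurent_simps gh)
    then show ?thesis
      unfolding k1_def k2_def A_def B_def h1_def by (simp only: laurent_simps laurent_ethb mu_laurent assms)
  qed
  ultimately show ?thesis using that by blast
qed

lemma bij_U1: "bij_betw U1 laurent laurent"
  unfolding bij_betw_def
proof (intro conjI inj_U1 subset_antisym subsetI)
  show "f \<in> laurent" if "f \<in> U1 ` laurent" for f using that U1_laurent by blast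
  show "f \<in> U1 ` laurent" if "f \<in> laurent" for f using U1_surj[OF that] by blast
qed

text \<open>
  For symmetric f the solution above has h_2 = 0, hence B = 0, and k_1 and x k_2 are both multiples of
  the lowering shift of f; their sum has this coefficient.
\<close>

definition U1_inv_coeff :: K where "U1_inv_coeff = (p * x + x1\<^sup>2) * (p\<^sup>2 - x1\<^sup>2) / (r * p\<^sup>2 * (1 - x1\<^sup>2))"

lemma op_inv_U1:
  assumes "f \<in> laurent" "s f = f"
  shows "op_inv U1 f = U1_inv_coeff * dn f"
proof (rule op_inv_eqI[OF bij_U1])
  have w: "U1_inv_coeff = (p * x + x1\<^sup>2) * (p\<^sup>2 - x1\<^sup>2) * inverse (r * p\<^sup>2 * (1 - x1\<^sup>2))"
    by (simp add: U1_inv_coeff_def divide_inverse)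
  show "U1_inv_coeff * dn f \<in> laurent"
    unfolding w by (simp only: laurent_simps laurent_ethb assms)
  define c where "c = (p\<^sup>2 - x1\<^sup>2) / (r * p\<^sup>2 * (1 - x1\<^sup>2))"
  define g where "g = c * dn f"
  have g: "s g = g" by (simp add: g_def c_def hom_simps symmetric_ops assms)
  have 1: "s (x1\<^sup>2 * g) = x1\<^sup>2 * g" "s (p * g) = p * g" by (simp_all add: hom_simps g)
  have "U1_inv_coeff * dn f = x1\<^sup>2 * g + x * (p * g)"
    by (simp add: U1_inv_coeff_def g_def c_def divide_inverse algebra_simps)
  then have "U1 (U1_inv_coeff * dn f) = up (p * g - p * (x1\<^sup>2 * g)) / (r * (1 - x1\<^sup>2))"
    using U1_symmetric_pair[OF 1] by (simp add: hom_simps qpow_numerals power_mult_distrib power_inverse divide_inverse)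
  also have "p * g - p * (x1\<^sup>2 * g) = (1 - x1\<^sup>2 / p\<^sup>2) * r * dn f"
    using xb_sq_neq[of 1] by (simp add: g_def c_def p_r divide_simps)
      (simp add: algebra_simps power_numeral_reduce)
  also have "up ((1 - x1\<^sup>2 / p\<^sup>2) * r * dn f) / (r * (1 - x1\<^sup>2)) = f"
    using xb_sq_neq[of 1] by (simp add: hom_simps ethb_inverse qpow_numerals power_mult_distrib)
  finally show "U1 (U1_inv_coeff * dn f) = f" .
qed

lemma U1_symmetric:
  assumes "s f = f"
  shows "U1 f = (mu * dn f - up f) * r / (1 - x1\<^sup>2)"
    "U1 (x * f) = (up f - mu * (x1\<^sup>2 / p\<^sup>2 * dn f)) / (r * (1 - x1\<^sup>2))"
proof -
  show "U1 f = (mu * dn f - up f) * r / (1 - x1\<^sup>2)"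
    using U1_expand[of f] assms by (simp add: K0_ladder ladder_def ethb.zero)
  show "U1 (x * f) = (up f - mu * (x1\<^sup>2 / p\<^sup>2 * dn f)) / (r * (1 - x1\<^sup>2))"
    using U1_symmetric_pair[OF s.zero assms] by (simp add: hom_simps)
qed

section \<open>The curve operators\<close>

text \<open>
  The inverse of U_0 or T_0 is the operator plus a multiple of the operator of the curve; substituting this, the terms
  with U_0 or T_0 cancel.  For the duals the computation is the same with x moved through \<sigma>.
\<close>

lemma ch_T0:
  assumes "f \<in> laurent"
  shows "ch_op (mult_op im \<circ> T0) f = ch x0 * f" "ch_op (mult_op im \<circ> T0_dual) f = ch x0 * f"
proof -
  have l: "- im * f \<in> laurent" "x * f \<in> laurent" by (simp_all only: laurent_simps assms)
  have T: "T0 (- im * f) = - im * T0 f" "T0 (- im * p * f) = - im * p * T0 f"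
    by (intro T0_linear const_intros)+
  show "ch_op (mult_op im \<circ> T0) f = ch x0 * f"
    unfolding ch_op_scaled[OF bij_T0 const_generators(2) im_nz assms] inverse_im op_inv_T0[OF l(1)] T
    by (simp add: algebra_simps) (simp add: im_im flip: mult.assoc)
  have "T0 (x * f) - p\<^sup>2 / x * T0 f = - im * ch x0 * (x + p) * f"
    using x_neq by (simp add: T0_def ch_def hom_simps qpow_numerals divide_simps)
      (simp add: algebra_simps power_numeral_reduce)
  then have X: "T0 (x * f) = p\<^sup>2 / x * T0 f - im * ch x0 * (x + p) * f"
    by (simp add: algebra_simps)
  show "ch_op (mult_op im \<circ> T0_dual) f = ch x0 * f"
    unfolding T0_dual_def ch_op_dual(2)[OF bij_T0 assms] op_inv_T0[OF l(2)] T X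
    by (simp add: divide_simps) (simp add: algebra_simps power2_eq_square, simp add: im_simps)
qed

lemma ch_U0:
  assumes "f \<in> laurent"
  shows "ch_op (mult_op im \<circ> U0) f = im / r * \<G> f" "ch_op (mult_op im \<circ> U0_dual) f = im / r * \<G> f"
proof -
  have l: "- im * f \<in> laurent" "x * f \<in> laurent" by (simp_all only: laurent_simps assms)
  have G: "\<G> (- im * f) = - im * \<G> f" "\<G> (x * f) = x * \<G> f" "\<K> (- im * f) = - im * \<K> f"
    "\<K> (p\<^sup>2 / x * f) = p\<^sup>2 / x * \<K> f"
    "\<K> (- im * p * f) = - im * p * \<K> f" "\<G> (- im * p * f) = - im * p * \<G> f" for f
    unfolding K0_ladder G0_ladder by (rule ladder_mult; simp add: hom_simps)+
  have U: "U0 (- im * f) = - im * U0 f" "U0 (- im * p * f) = - im * p * U0 f"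
    by (simp_all only: U0_factored G sigma_ops sigma.uminus sigma_const const_generators) (simp_all add: algebra_simps)
  show "ch_op (mult_op im \<circ> U0) f = im / r * \<G> f"
    unfolding ch_op_scaled[OF bij_U0 const_generators(2) im_nz assms] inverse_im op_inv_U0[OF l(1)] U G
    by (simp add: algebra_simps)
  have X: "op_inv U0 (x * f) = U0_factor * (p\<^sup>2 / x) * \<K> (\<sigma> f) + \<sigma> U0_factor * x * \<G> f"
    using op_inv_U0[OF l(2)] unfolding U0_inverse_expand by (simp only: sigma_ops sigma_x G mult.assoc)
  show "ch_op (mult_op im \<circ> U0_dual) f = im / r * \<G> f"
    unfolding U0_dual_def ch_op_dual(2)[OF bij_U0 assms] U X sigma_U0_factor unfolding U0_factored U0_factor_def using x_neq
    by (simp add: divide_simps)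
      (simp add: algebra_simps power_numeral_reduce)
qed

lemma scalar_facts: "im * qpow (- 2) \<in> range rconst" "im * qpow (- 2) \<noteq> 0" "inverse (im * qpow (- 2)) = - im * p"
  by (simp_all add: const_intros qpow_numerals inverse_im)

lemma ch_T1:
  assumes "f \<in> laurent" "s f = f"
  shows "ch_op (mult_op (im * qpow (- 2)) \<circ> T1) f = ch x1 * f" "ch_op (mult_op im \<circ> T1_dual) f = ch x1 * f"
proof -
  have l: "- im * p * f \<in> laurent" "s (- im * p * f) = - im * p * f"
    by (simp_all only: laurent_simps assms hom_simps im_fixed qpow_fixed)
  have T: "T1 (- im * x * f) = - im * T1 (x * f)"
    unfolding mult.assoc by (intro T1_linear const_intros)+
  show "ch_op (mult_op (im * qpow (- 2)) \<circ> T1) f = ch x1 * f"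
    unfolding ch_op_scaled[OF bij_T1 scalar_facts(1,2) assms(1)] scalar_facts(3) op_inv_T1_symmetric[OF l] T1_symmetric[OF assms(2)]
    by (simp add: t1_def ch_def inverse_im qpow_numerals algebra_simps) (simp add: im_simps algebra_simps)
  show "ch_op (mult_op im \<circ> T1_dual) f = ch x1 * f"
    unfolding T1_dual_def ch_op_dual(1)[OF bij_T1 assms(1)] op_inv_T1_symmetric[OF assms] T T1_symmetric[OF assms(2)]
    by (simp add: t1_def ch_def qpow_numerals divide_simps)
      (simp add: im_simps algebra_simps power_numeral_reduce)
qed

lemma ch_U1:
  assumes "f \<in> laurent" "s f = f"
  shows "ch_op (mult_op (im * qpow (- 2)) \<circ> U1) f = im / r * G0 1 x f"
    "ch_op (mult_op im \<circ> U1_dual) f = im / r * G0 1 x f"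
proof -
  have l: "- im * p * f \<in> laurent" "s (- im * p * f) = - im * p * f" "s (- im * f) = - im * f"
    by (simp_all only: laurent_simps assms hom_simps im_fixed qpow_fixed)
  have T: "U1 (- im * x * f) = U1 (x * (- im * f))"
    by (simp add: mult_ac)
  show "ch_op (mult_op (im * qpow (- 2)) \<circ> U1) f = im / r * G0 1 x f"
    unfolding ch_op_scaled[OF bij_U1 scalar_facts(1,2) assms(1)] scalar_facts(3) op_inv_U1[OF l(1,2)] U1_symmetric[OF assms(2)]
      G0_ladder ladder_def G_coeff_def U1_inv_coeff_def mu_def using xb_sq_neq[of 1]
    by (simp add: hom_simps qpow_numerals p_r divide_simps)
      (simp add: algebra_simps power_numeral_reduce)
  show "ch_op (mult_op im \<circ> U1_dual) f = im / r * G0 1 x f"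
    unfolding U1_dual_def ch_op_dual(1)[OF bij_U1 assms(1)] op_inv_U1[OF assms] T U1_symmetric[OF l(3)]
      G0_ladder ladder_def G_coeff_def U1_inv_coeff_def mu_def using xb_sq_neq[of 1]
    by (simp add: hom_simps qpow_numerals p_r divide_simps)
      (simp add: algebra_simps power_numeral_reduce)
qed

text \<open>
  The two orders give the same result because T_0 commutes with t_1 and T_1^(-1) = T_1 + t_1 - 1 / t_1,
  where T_1 acts on f as 1 / t_1.
\<close>

lemma ch_T1_T0:
  assumes "f \<in> laurent" "s f = f"
  shows "ch_op (T1 \<circ> T0) f = T1 (T0 f) + t1 * T0 f + t1 * im * ch x0 * f"
   "ch_op (T0 \<circ> T1) f = T1 (T0 f) + t1 * T0 f + t1 * im * ch x0 * f"
proof -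
  have c: "inverse t1 \<in> range rconst" "t1 \<in> range rconst" "im * ch x0 \<in> range rconst"
    by (intro const_intros const_ch_t1)+
  have l: "T0 f + im * ch x0 * f \<in> laurent" "t1 * f \<in> laurent"
    by (simp_all only: T0_laurent laurent_simps assms)
  show "ch_op (T1 \<circ> T0) f = T1 (T0 f) + t1 * T0 f + t1 * im * ch x0 * f"
    unfolding ch_op_comp[OF bij_T1 bij_T0 assms(1)] op_inv_T1_symmetric[OF assms] op_inv_T0[OF l(2)] T0_linear(3)[OF c(2)]
    by (simp add: algebra_simps)
  show "ch_op (T0 \<circ> T1) f = T1 (T0 f) + t1 * T0 f + t1 * im * ch x0 * f"
    unfolding ch_op_comp[OF bij_T0 bij_T1 assms(1)] T1_symmetric(1)[OF assms(2)]
      op_inv_T0[OF assms(1)] op_inv_T1[OF l(1)] T0_linear(3)[OF c(1)] T1_linear(1,2) T1_linear(3)[OF c(3)]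
    unfolding T1_symmetric(1)[OF assms(2)]
    using t1_nz by (simp add: algebra_simps)
qed

text \<open>
  With h = T_0 f and c the coefficient of s in T_1 one has T_1 h + t_1 h = c s(h) + s(c) h.  Since f is symmetric,
  h and s(h) involve f together with one of the two shifts each, so the coefficients of eth f, eth^(-1) f and f can be
  read off.
\<close>

lemma curve_k3_eq:
  assumes "s f = f"
  shows "\<A> k3 f = T1 (T0 f) + t1 * T0 f + t1 * im * ch x0 * f"
proof -
  define h where "h = T0 f"
  define c where "c = im * ((1 + p * x) / (p * (1 - x\<^sup>2)) * ((p * x + x1\<^sup>2) / x1))"
  have 1: "T1 h + t1 * h = c * s h + s c * h"
    using x_neq by (simp add: T1_def t1_def c_def hom_simps qpow_numerals divide_simps)
      (simp add: algebra_simps power_numeral_reduce)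
  define A where "A = im * (x / (p - x)) * ch x0"
  define B where "B = - (im * (x / (p - x)) * ((p + x * x0\<^sup>2) / (x * x0)))"
  have h: "h = A * f + B * eth (- 1) f"
    by (simp add: h_def T0_def A_def B_def ch_def s_eth assms divide_inverse algebra_simps)
  have sh: "s h = s A * f + s B * eth 1 f"
    unfolding h by (simp add: hom_simps s_eth assms)
  have sA: "s A = im * (1 / (p * x - 1)) * ch x0"
    using x_neq by (simp add: A_def ch_def hom_simps divide_simps)
  have sB: "s B = - (im * ((p * x + x0\<^sup>2) / (x0 * (p * x - 1))))"
    using x_neq by (simp add: B_def hom_simps divide_simps)
  have sc: "s c = im * ((x + p) / (p * (x\<^sup>2 - 1)) * ((p + x1\<^sup>2 * x) / x1))"
    using x_neq by (simp add: c_def hom_simps divide_simps)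
      (simp add: algebra_simps power_numeral_reduce)
  have e1: "c * s B = \<omega> x * (- (inverse x) * (x0 + p * x / x0) * (x1 + p * x / x1))"
    unfolding sB using x_neq by (simp add: c_def \<omega>_def divide_simps)
      (simp add: im_simps algebra_simps power_numeral_reduce)
  have e2: "s c * B = \<omega> (inverse x) * (- x * (x0 + p * inverse x / x0) * (x1 + p * inverse x / x1))"
    unfolding sc using x_neq by (simp add: B_def \<omega>_def divide_simps)
      (simp add: im_simps algebra_simps power_numeral_reduce)
  have e3: "c * s A + s c * A + t1 * im * ch x0 = (\<omega> x + \<omega> (inverse x)) * (p * ch x0 * ch x1)"
    unfolding sc sA using x_neq by (simp add: A_def c_def t1_def ch_def \<omega>_def qpow_numerals divide_simps)
     (simp add: im_simps algebra_simps power_numeral_reduce)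
  have "T1 (T0 f) + t1 * T0 f + t1 * im * ch x0 * f
    = (c * s B) * eth 1 f + (s c * B) * eth (- 1) f + (c * s A + s c * A + t1 * im * ch x0) * f"
    using 1 unfolding h_def[symmetric] by (simp add: sh) (simp add: h algebra_simps)
  also have "\<dots> = \<A> k3 f"
    unfolding e1 e2 e3 by (simp add: divide_inverse algebra_simps)
  finally show ?thesis ..
qed

text \<open>
  Both sides are linear in X = K_0(x_0, x) eth f, its reflection Y and Z = G f.  The operators in x_0 commute
  with the shifts of x_1, so after the operators in x_1 are expanded only the coefficients of X, the two shifts
  of Y and the two shifts of Z have to be compared; these are the facts e1 to e5.
\<close>

lemma curve_k6_eq:
  assumes "f \<in> laurent" "s f = f"
  shows "\<A> k6 f = ch_op (U1 \<circ> U0) f"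
proof -
  define X where "X = K0 0 x (eth 1 f)"
  define Y where "Y = \<K> (eth (- 1) f)"
  define Z where "Z = \<G> f"
  define K where "K = K0 1 x"
  have sY: "s Y = X" and sZ: "s Z = Z"
    by (simp_all add: X_def Y_def Z_def K0_ladder G0_ladder s_ladder s_eth assms K_coeff_def G_coeff_def hom_simps)
     (simp add: divide_simps mult_ac)
  have sigma_f: "\<sigma> f = eth (- 1) f"
    by (simp add: s_eth assms)
  define h where "h = U0_factor * (Y - Z)"
  have U0: "U0 f = h"
    by (simp only: U0_factored sigma_f h_def Y_def Z_def)
  have suu: "s U0_factor = 1 / (r * (p * x - 1))"
    using x_neq by (simp add: U0_factor_def hom_simps divide_simps)
  define a where "a = s U0_factor / (1 - x\<^sup>2)"
  define b where "b = - U0_factor / (1 - x\<^sup>2)"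
  have D: "(s h - h) / (1 - x\<^sup>2) = a * X + b * Y - (a + b) * Z"
    by (simp add: h_def hom_simps sY sZ a_def b_def divide_inverse algebra_simps)
  have ab: "ethb 1 e a = a" "ethb 1 e b = b" for e
    unfolding a_def b_def suu by (simp_all add: U0_factor_def hom_simps)
  have K: "K (a * X + b * Y - (a + b) * Z) = a * K X + b * K Y - (a + b) * K Z"
    unfolding K_def K0_ladder ladder_diff ladder_add
    by (simp add: ladder_mult ab hom_simps del: One_nat_def)
  have U1: "U1 h = (mu * dn h - up h) * r / (1 - x1\<^sup>2) - x * (1 + p * x) / r * (a * K X + b * K Y - (a + b) * K Z)"
    unfolding U1_expand D K_def[symmetric] K ..
  have w: "ethb 0 e U1_inv_coeff = U1_inv_coeff" "ethb 0 e (\<sigma> U1_inv_coeff) = \<sigma> U1_inv_coeff" for e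
    by (simp_all add: U1_inv_coeff_def hom_simps)
  have "\<sigma> (U1_inv_coeff * dn f) = \<sigma> U1_inv_coeff * dn (eth (- 1) f)"
    by (simp only: sigma_ops ethb_eth[symmetric] ethb_s[symmetric] sigma_f)
  then have L: "\<K> (\<sigma> (U1_inv_coeff * dn f)) = \<sigma> U1_inv_coeff * dn Y"
    unfolding K0_ladder Y_def by (simp only: ladder_mult[OF w(2) w(2)] ladder_ethb[OF coeff_fixed(2)])
  have G: "\<G> (U1_inv_coeff * dn f) = U1_inv_coeff * dn Z"
    unfolding G0_ladder Z_def by (simp only: ladder_mult[OF w(1) w(1)] ladder_ethb[OF coeff_fixed(3)])
  have wl: "op_inv U1 f \<in> laurent"
    using bij_op_inv[OF bij_U1] assms(1) by (auto simp: bij_betw_def)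
  have inv: "op_inv U0 (op_inv U1 f) = U0_factor * (\<sigma> U1_inv_coeff * dn Y) + \<sigma> U0_factor * (U1_inv_coeff * dn Z)"
    unfolding op_inv_U0[OF wl] unfolding U0_inverse_expand unfolding op_inv_U1[OF assms] L G ..
  have "\<A> k6 f = \<omega> x * (K X - G0 1 x Z) + \<omega> (inverse x) * (K0 1 (inverse x) Y - G0 1 x Z)"
    by (simp add: X_def Y_def Z_def K_def K0_ladder G0_ladder ladder_commute coeff_fixed del: One_nat_def)
  also have "\<dots> = U1 h + (U0_factor * (\<sigma> U1_inv_coeff * dn Y) + \<sigma> U0_factor * (U1_inv_coeff * dn Z))"
  proof -
    define c where "c = inverse (1 - x1\<^sup>2)"
    have exp: "K0 1 x g = c * (K_coeff 1 x * dn g - up g)" "K0 1 (inverse x) g = c * (K_coeff 1 (inverse x) * dn g - up g)"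
        "G0 1 x g = c * (G_coeff 1 * dn g - up g)" for g
      unfolding K0_ladder G0_ladder ladder_def c_def by (simp_all add: divide_inverse)
    have uuf: "ethb 1 e U0_factor = U0_factor" for e by (rule U0_factor_fixed)
    have U1_inv_coeff: "U1_inv_coeff = c * ((p * x + x1\<^sup>2) * (p\<^sup>2 - x1\<^sup>2) / (r * p\<^sup>2))"
      by (simp add: U1_inv_coeff_def c_def divide_inverse)
    have sc: "\<sigma> c = c" by (simp add: c_def hom_simps)
    have sww: "\<sigma> U1_inv_coeff = c * ((p ^ 3 / x + x1\<^sup>2) * (p\<^sup>2 - x1\<^sup>2) / (r * p\<^sup>2))"
      unfolding U1_inv_coeff sigma_ops sc
      by (simp add: hom_simps qpow_numerals divide_inverse power_numeral_reduce mult_ac)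
    define l where "l = x * (1 + p * x) / r"
    have e1: "\<omega> x = - l * a"
      using x_neq by (simp add: \<omega>_def l_def a_def suu p_r divide_simps)
      (simp add: algebra_simps power_numeral_reduce)
    have e2: "\<omega> (inverse x) = U0_factor * r - l * b"
      using x_neq by (simp add: \<omega>_def l_def b_def U0_factor_def p_r divide_simps)
      (simp add: algebra_simps power_numeral_reduce)
    have e3: "\<omega> (inverse x) * K_coeff 1 (inverse x) =
        mu * r * U0_factor - l * b * K_coeff 1 x + U0_factor * ((p ^ 3 / x + x1\<^sup>2) * (p\<^sup>2 - x1\<^sup>2) / (r * p\<^sup>2))"
      using x_neq by (simp add: \<omega>_def l_def b_def U0_factor_def K_coeff_def mu_def p_r divide_simps)
      (simp add: algebra_simps power_numeral_reduce)
    have e4: "\<omega> x + \<omega> (inverse x) = U0_factor * r - l * (a + b)"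
      unfolding e1 e2 by (simp add: algebra_simps)
    have e5: "(\<omega> x + \<omega> (inverse x)) * G_coeff 1 = mu * r * U0_factor - l * (a + b) * K_coeff 1 x
        - \<sigma> U0_factor * ((p * x + x1\<^sup>2) * (p\<^sup>2 - x1\<^sup>2) / (r * p\<^sup>2))"
    proof -
      have ur: "r * U0_factor = x / (p - x)" by (simp add: U0_factor_def)
      have W: "\<sigma> U0_factor * ((p * x + x1\<^sup>2) * (p\<^sup>2 - x1\<^sup>2) / (r * p\<^sup>2))
          = - ((p * x + x1\<^sup>2) * (p\<^sup>2 - x1\<^sup>2) / (p\<^sup>2 * (p - x)))"
        unfolding sigma_U0_factor using x_neq by (simp add: divide_simps)
      (simp add: p_r algebra_simps power_numeral_reduce)
      have "(\<omega> x + \<omega> (inverse x)) * (G_coeff 1 - K_coeff 1 x) = x / (p - x) * (mu - K_coeff 1 x)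
          + (p * x + x1\<^sup>2) * (p\<^sup>2 - x1\<^sup>2) / (p\<^sup>2 * (p - x))"
        using x_neq by (simp add: \<omega>_def K_coeff_def G_coeff_def mu_def divide_simps)
      (simp add: algebra_simps power_numeral_reduce)
      moreover have "mu * r * U0_factor - l * (a + b) * K_coeff 1 x = x / (p - x) * (mu - K_coeff 1 x) + (\<omega> x + \<omega> (inverse x)) * K_coeff 1 x"
        unfolding e4 ur[symmetric] by (simp add: algebra_simps)
      ultimately show ?thesis
        unfolding W by (simp add: algebra_simps)
    qed
    have "U1 h + (U0_factor * (\<sigma> U1_inv_coeff * dn Y) + \<sigma> U0_factor * (U1_inv_coeff * dn Z)) =
       - l * a * K X + c * ((mu * r * U0_factor - l * b * K_coeff 1 x + U0_factor * ((p ^ 3 / x + x1\<^sup>2) * (p\<^sup>2 - x1\<^sup>2) / (r * p\<^sup>2))) * dn Y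
         - (U0_factor * r - l * b) * up Y)
       - c * ((mu * r * U0_factor - l * (a + b) * K_coeff 1 x
        - \<sigma> U0_factor * ((p * x + x1\<^sup>2) * (p\<^sup>2 - x1\<^sup>2) / (r * p\<^sup>2))) * dn Z - (U0_factor * r - l * (a + b)) * up Z)"
      unfolding U1 sww unfolding U1_inv_coeff l_def[symmetric] unfolding h_def hom_simps uuf K_def exp
      by (simp add: divide_inverse c_def[symmetric] del: One_nat_def) (simp add: algebra_simps)
    also have "\<dots> = \<omega> x * (K X - G0 1 x Z) + \<omega> (inverse x) * (K0 1 (inverse x) Y - G0 1 x Z)"
      unfolding e1[symmetric] e2[symmetric] e3[symmetric] e4[symmetric] e5[symmetric] exp
      by (simp add: algebra_simps)
    finally show ?thesis ..
  qed
  also have "\<dots> = ch_op (U1 \<circ> U0) f"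
    unfolding ch_op_comp[OF bij_U1 bij_U0 assms(1)] inv U0 ..
  finally show ?thesis .
qed

theorem proposition3p3:
  shows "\<forall>f\<in>laurent.
      \<A> k1 f = ch_op (mult_op im \<circ> T0) f
    \<and> \<A> k1 f = ch_op (mult_op im \<circ> T0_dual) f
    \<and> \<A> k2 f = ch_op (mult_op im \<circ> U0) f
    \<and> \<A> k2 f = ch_op (mult_op im \<circ> U0_dual) f
    \<and> (\<A> k3 \<circ> idem) f = (ch_op (T1 \<circ> T0) \<circ> idem) f
    \<and> (\<A> k3 \<circ> idem) f = (ch_op (T0 \<circ> T1) \<circ> idem) f
    \<and> (\<A> k4 \<circ> idem) f = (ch_op (mult_op (im * qpow (- 2)) \<circ> U1) \<circ> idem) f
    \<and> (\<A> k4 \<circ> idem) f = (ch_op (mult_op im \<circ> U1_dual) \<circ> idem) f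
    \<and> (\<A> k5 \<circ> idem) f = (ch_op (mult_op (im * qpow (- 2)) \<circ> T1) \<circ> idem) f
    \<and> (\<A> k5 \<circ> idem) f = (ch_op (mult_op im \<circ> T1_dual) \<circ> idem) f
    \<and> (\<A> k6 \<circ> idem) f = (ch_op (U1 \<circ> U0) \<circ> idem) f"
proof (intro ballI)
  fix f assume f: "f \<in> laurent"
  note e = idem_laurent[OF f] s_idem[of f]
  have k1: "\<A> k1 g = ch x0 * g" and k2: "\<A> k2 g = im / r * \<G> g"
    and k4: "\<A> k4 g = im / r * G0 1 x g" and k5: "\<A> k5 g = ch x1 * g" for g
    by (simp_all add: mult_op_def qpow_numerals divide_inverse)
  show "\<A> k1 f = ch_op (mult_op im \<circ> T0) f
    \<and> \<A> k1 f = ch_op (mult_op im \<circ> T0_dual) f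
    \<and> \<A> k2 f = ch_op (mult_op im \<circ> U0) f
    \<and> \<A> k2 f = ch_op (mult_op im \<circ> U0_dual) f
    \<and> (\<A> k3 \<circ> idem) f = (ch_op (T1 \<circ> T0) \<circ> idem) f
    \<and> (\<A> k3 \<circ> idem) f = (ch_op (T0 \<circ> T1) \<circ> idem) f
    \<and> (\<A> k4 \<circ> idem) f = (ch_op (mult_op (im * qpow (- 2)) \<circ> U1) \<circ> idem) f
    \<and> (\<A> k4 \<circ> idem) f = (ch_op (mult_op im \<circ> U1_dual) \<circ> idem) f
    \<and> (\<A> k5 \<circ> idem) f = (ch_op (mult_op (im * qpow (- 2)) \<circ> T1) \<circ> idem) f
    \<and> (\<A> k5 \<circ> idem) f = (ch_op (mult_op im \<circ> T1_dual) \<circ> idem) f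
    \<and> (\<A> k6 \<circ> idem) f = (ch_op (U1 \<circ> U0) \<circ> idem) f"
    unfolding o_apply[of _ idem]
      ch_T0[OF f] ch_U0[OF f] ch_T1_T0[OF e] curve_k3_eq[OF e(2)] ch_U1[OF e] ch_T1[OF e] curve_k6_eq[OF e] k1 k2 k4 k5
    by blast
qed

end
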